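(* Let $m \ge 3$, and let $n(m)$ be the number of CCZ-inequivalent Taniguchi APN functions on $\mathbb{F}_{2^{2m}}$, i.e. the number of CCZ-equivalence classes represented by the Taniguchi APN functions $f_{k,\alpha,\beta}$ on $\mathbb{F}_{2^{2m}}$. Then $$n(m) \ge \frac{\varphi(m)}{2}\left\lceil\frac{2^m+1}{3m}\right\rceil,$$ where $\varphi$ denotes Euler's totient function.
   Context: Identify $\mathbb{F}_{2^{2m}}$ with $\mathbb{F}_{2^m}^2$ as $\mathbb{F}_2$-vector spaces. A function $f$ on $\mathbb{F}_2^n$ is APN if for every $b$ and every nonzero $a$ the equation $f(x+a)+f(x)=b$ has exactly $0$ or $2$ solutions. A Taniguchi APN function on $\mathbb{F}_{2^{2m}}$ is a function $f_{k,\alpha,\beta}(x,y)=(x^{2^{2k}(2^k+1)}+\alpha x^{2^{2k}}y^{2^k}+\beta y^{2^k+1},\,xy)$ on $\mathbb{F}_{2^m}^2$, where $k$ is a positive integer with $\gcd(k,m)=1$, $\alpha,\beta\in\mathbb{F}_{2^m}$, $\beta\ne0$, that is APN; equivalently (Taniguchi), such that $X^{2^k+1}+\alpha X+\beta$ has no root in $\mathbb{F}_{2^m}$. Two functions $f,g$ on $\mathbb{F}_2^n$ are CCZ-equivalent if there is an affine permutation $C$ (over $\mathbb{F}_2$) of $\mathbb{F}_{2}^n \times \mathbb{F}_{2}^n$ with $C(G_f)=G_g$, where $G_f=\{(x,f(x)) : x\in\mathbb{F}_2^n\}$. *)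

theory Defs
  imports Complex_Main "HOL-Library.Product_Plus" "HOL-Library.Z2" "HOL-Library.Cardinality"
    "HOL-Number_Theory.Totient"
begin

text \<open>The field with \<open>2 ^ m\<close> elements is a type \<open>'a :: {finite, field}\<close> with \<open>CARD('a) = 2 ^ m\<close>,
  and \<open>'a \<times> 'a\<close> plays the role of the field with \<open>2 ^ (2 * m)\<close> elements. The notions
  below only use the additive structure of \<open>'v\<close>, seen as a vector space over
  the two-element field \<^typ>\<open>bit\<close>.\<close>

definition scale2 :: "bit \<Rightarrow> 'v::ab_group_add \<Rightarrow> 'v" where
  "scale2 c v = (if c = 1 then v else 0)"

text \<open>The locale predicate \<^const>\<open>Vector_Spaces.linear\<close> includes the vector space axioms, which hold for
  \<^const>\<open>scale2\<close> exactly when \<open>v + v = 0\<close> for all \<open>v\<close>.\<close>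

lemma vector_space_scale2_iff:
  "vector_space (scale2 :: bit \<Rightarrow> 'v::ab_group_add \<Rightarrow> 'v) \<longleftrightarrow> (\<forall>v::'v. v + v = 0)"
proof
  assume vs: "vector_space (scale2 :: bit \<Rightarrow> 'v \<Rightarrow> 'v)"
  show "\<forall>v::'v. v + v = 0"
  proof
    fix v :: 'v
    have "scale2 (1 + 1) v = scale2 1 v + scale2 1 v"
      using vs unfolding vector_space_def by blast
    then show "v + v = 0" by (simp add: scale2_def)
  qed
next
  assume "\<forall>v::'v. v + v = 0"
  then show "vector_space (scale2 :: bit \<Rightarrow> 'v \<Rightarrow> 'v)"
    unfolding vector_space_def scale2_def by auto
qed

definition affine_permutation2 :: "('v::ab_group_add \<Rightarrow> 'v) \<Rightarrow> bool" where
  "affine_permutation2 C \<longleftrightarrow>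
     bij C \<and> (\<exists>L c. Vector_Spaces.linear scale2 scale2 L \<and> (\<forall>z. C z = L z + c))"

definition apn :: "('v::{finite, ab_group_add} \<Rightarrow> 'v) \<Rightarrow> bool" where
  "apn f \<longleftrightarrow> (\<forall>b a. a \<noteq> 0 \<longrightarrow> card {x. f (x + a) + f x = b} \<in> {0, 2})"

definition fun_graph :: "('v \<Rightarrow> 'v) \<Rightarrow> ('v \<times> 'v) set" where
  "fun_graph f = {(x, f x) | x. True}"

definition ccz_equivalent :: "('v::ab_group_add \<Rightarrow> 'v) \<Rightarrow> ('v \<Rightarrow> 'v) \<Rightarrow> bool" where
  "ccz_equivalent f g \<longleftrightarrow> (\<exists>C. affine_permutation2 C \<and> C ` fun_graph f = fun_graph g)"

definition taniguchi :: "nat \<Rightarrow> 'a::field \<Rightarrow> 'a \<Rightarrow> 'a \<times> 'a \<Rightarrow> 'a \<times> 'a" where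
  "taniguchi k \<alpha> \<beta> = (\<lambda>(x, y).
     (x ^ (2 ^ (2 * k) * (2 ^ k + 1)) + \<alpha> * x ^ (2 ^ (2 * k)) * y ^ (2 ^ k) + \<beta> * y ^ (2 ^ k + 1),
      x * y))"

definition taniguchi_apn :: "nat \<Rightarrow> ('a::{finite, field} \<times> 'a \<Rightarrow> 'a \<times> 'a) set" where
  "taniguchi_apn m =
     {taniguchi k \<alpha> \<beta> | k \<alpha> \<beta>. k > 0 \<and> gcd k m = 1 \<and> \<beta> \<noteq> 0 \<and> apn (taniguchi k \<alpha> \<beta>)}"

text \<open>The CCZ classes counted here are classes of arbitrary functions, of which only those
  containing a Taniguchi APN function are taken.\<close>

definition num_taniguchi_classes :: "'a::{finite, field} itself \<Rightarrow> nat \<Rightarrow> nat" where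
  "num_taniguchi_classes _ m =
     card ((taniguchi_apn m :: ('a \<times> 'a \<Rightarrow> 'a \<times> 'a) set) // {(f, g). ccz_equivalent f g})"

end

theory Submission
  imports Defs "HOL-Library.Disjoint_Sets" "HOL-Computational_Algebra.Polynomial" "HOL-Library.FuncSet"
begin

text \<open>For a quadratic APN function \<open>f\<close> with \<open>f 0 = 0\<close>, the maps
  \<open>(x, y) \<mapsto> (x + a, y + B(x, a) + f a)\<close>, \<open>B\<close> the polarization of \<open>f\<close>, form an elementary abelian
  group acting regularly on the graph of \<open>f\<close>. If another such group \<open>T'\<close> on the same graph
  normalizes this group \<open>T\<close>, then \<open>T'\<close> centralizes a nontrivial element of \<open>T\<close>, which therefore
  lies in \<open>T'\<close>, and comparing ranks of the linear parts gives \<open>T' = T\<close>. Counting fixed points of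
  2-groups on the conjugates of \<open>T\<close> modulo 2, as in Sylow's theorem, shows that all these groups
  are conjugate. Hence CCZ-equivalent quadratic APN functions have linearly equivalent
  polarizations (Yoshiara's theorem).

  After the substitution \<open>y \<mapsto> y ^ (q\<^sup>2)\<close>, where \<open>q = 2 ^ k\<close>, the polarization of a Taniguchi
  function with \<open>\<alpha> = 1\<close> has exactly the scalars as derivations (\<open>m \<ge> 4\<close>). So an equivalence is
  semilinear, and comparing coefficients leaves only equal \<open>k\<close> and \<open>\<beta>\<close> conjugate under Frobenius.
  Finally \<open>X ^ (q + 1) + X + \<beta>\<close> has no root for at least \<open>(2 ^ m - 1) / 3\<close> values of \<open>\<beta>\<close>; the case
  \<open>\<alpha> = 0\<close> is not needed for the bound.\<close>

section \<open>CCZ-equivalence of quadratic APN functions\<close>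

lemma even_card_involution:
  assumes "\<And>x. x \<in> S \<Longrightarrow> i x \<in> S" "\<And>x. x \<in> S \<Longrightarrow> i (i x) = x"
    and "\<And>x. x \<in> S \<Longrightarrow> i x \<noteq> x"
  shows "even (card S)"
proof -
  have "(\<Sum>x\<in>S. (1::bit)) = 0"
    using assms by (intro sum_involution_eq_0[where h = i]) auto
  then have "of_nat (card S) = (0::bit)" by simp
  moreover have "of_nat n = (0::bit) \<longleftrightarrow> even n" for n
    by (induction n) auto
  ultimately show ?thesis by blast
qed

text \<open>\<open>\<Phi>\<close> is an action of an elementary abelian 2-group. If a group element
  moves one point of an orbit, it moves all of them because the group is abelian. Being an
  involution, it pairs off the orbit, and the rest follows by induction.\<close>

lemma even_card_nonfixed:
  fixes \<Phi> :: "'v::ab_group_add \<Rightarrow> 's \<Rightarrow> 's"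
  assumes "finite X" and two: "\<And>a::'v. a + a = 0"
    and "\<And>a x. x \<in> X \<Longrightarrow> \<Phi> a x \<in> X"
    and "\<And>a b x. x \<in> X \<Longrightarrow> \<Phi> (a + b) x = \<Phi> a (\<Phi> b x)"
    and "\<And>x. x \<in> X \<Longrightarrow> \<Phi> 0 x = x"
  shows "even (card {x \<in> X. \<exists>a. \<Phi> a x \<noteq> x})"
  using assms(1,3-)
proof (induction X rule: finite_psubset_induct)
  case (psubset X)
  note maps = psubset.prems(1) and add = psubset.prems(2) and zero = psubset.prems(3)
  show ?case
  proof (cases "{x \<in> X. \<exists>a. \<Phi> a x \<noteq> x} = {}")
    case True
    then show ?thesis by (simp only: card.empty even_zero)
  next
    case False
    then obtain x a where x: "x \<in> X" "\<Phi> a x \<noteq> x" by blast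
    define Q where "Q = range (\<lambda>b. \<Phi> b x)"
    have QX: "Q \<subseteq> X" using maps x by (auto simp: Q_def)
    have xQ: "x \<in> Q" unfolding Q_def using zero[OF x(1)] by (metis rangeI)
    have inv: "\<Phi> a (\<Phi> a y) = y" if "y \<in> X" for a y
      using add[OF that, of a a] zero[OF that] two by simp
    have Qmaps: "\<Phi> c y \<in> Q" if "y \<in> Q" for c y
      using that add[OF x(1)] unfolding Q_def by (auto intro!: image_eqI[of _ _ "c + _"])
    have moved: "\<Phi> a y \<noteq> y" if y: "y \<in> Q" for y
    proof
      assume eq: "\<Phi> a y = y"
      obtain b where b: "y = \<Phi> b x" using y by (auto simp: Q_def)
      have "\<Phi> b (\<Phi> a x) = \<Phi> b x"
        using eq b add[OF x(1), of a b] add[OF x(1), of b a] by (simp add: add.commute)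
      then have "\<Phi> b (\<Phi> b (\<Phi> a x)) = \<Phi> b (\<Phi> b x)" by simp
      then show False using inv x maps by simp
    qed
    have evQ: "even (card Q)"
      by (rule even_card_involution[where i = "\<Phi> a"]) (use Qmaps inv QX moved in auto)
    have "even (card {y \<in> X - Q. \<exists>a. \<Phi> a y \<noteq> y})"
    proof (rule psubset.IH)
      show "X - Q \<subset> X" using QX xQ by blast
      show "\<Phi> c y \<in> X - Q" if "y \<in> X - Q" for c y
        using that maps Qmaps inv by (metis DiffD1 DiffD2 DiffI)
    qed (use add zero in auto)
    moreover have "{y \<in> X. \<exists>a. \<Phi> a y \<noteq> y} = Q \<union> {y \<in> X - Q. \<exists>a. \<Phi> a y \<noteq> y}"
      using QX moved by blast
    moreover have "finite Q" using QX psubset.hyps finite_subset by blast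
    ultimately show ?thesis using evQ psubset.hyps
      by (simp add: card_Un_disjoint Int_def disjnt_def)
  qed
qed

text \<open>The inequality half of rank-nullity: choosing a preimage of each value and adding kernel
  elements never repeats an element of the domain.\<close>

lemma card_range_mult_card_kernel_le:
  fixes h :: "'v::{finite, ab_group_add} \<Rightarrow> 'w::ab_group_add"
  assumes "additive h"
  shows "card (range h) * card {x. h x = 0} \<le> CARD('v)"
proof -
  interpret additive h by fact
  let ?F = "\<lambda>(r, z). inv h r + z"
  have eq: "h (?F p) = fst p" if "p \<in> range h \<times> {x. h x = 0}" for p
    using that by (auto simp: add f_inv_into_f)
  have "inj_on ?F (range h \<times> {x. h x = 0})"
  proof (rule inj_onI)
    fix p p' assume p: "p \<in> range h \<times> {x. h x = 0}" "p' \<in> range h \<times> {x. h x = 0}"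
      and "?F p = ?F p'"
    moreover have "fst p = fst p'" using calculation eq by metis
    ultimately show "p = p'" by (auto simp: prod_eq_iff split: prod.splits)
  qed
  then have "card (range h \<times> {x. h x = 0}) \<le> CARD('v)"
    by (metis card_inj_on_le finite subset_UNIV)
  then show ?thesis by (simp add: card_cartesian_product)
qed

section \<open>Affine bijections and their linear parts\<close>

definition affine_bij :: "('v::ab_group_add \<Rightarrow> 'v) \<Rightarrow> bool" where
  "affine_bij C \<longleftrightarrow> bij C \<and> additive (\<lambda>z. C z - C 0)"

abbreviation linear_part :: "('v::ab_group_add \<Rightarrow> 'v) \<Rightarrow> 'v \<Rightarrow> 'v" where
  "linear_part C \<equiv> \<lambda>z. C z - C 0"

lemma affine_bijI:
  assumes "bij C" "additive L" "\<And>z. C z = L z + c"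
  shows "affine_bij C"
  using assms additive.zero[OF assms(2)] additive.add[OF assms(2)]
  by (simp add: affine_bij_def additive_def)

lemma affine_bij_add_diff:
  assumes "affine_bij C"
  shows "C (x + y - z) = C x + C y - C z"
proof -
  interpret additive "linear_part C" using assms by (simp add: affine_bij_def)
  show ?thesis using diff[of "x + y" z] add[of x y] by (simp add: algebra_simps)
qed

text \<open>Preserving \<open>x + y - z\<close> is an origin-free form of affinity, which makes
  closure under composition and inversion immediate.\<close>

lemma affine_bij_iff: "affine_bij C \<longleftrightarrow> bij C \<and> (\<forall>x y z. C (x + y - z) = C x + C y - C z)"
proof
  assume "bij C \<and> (\<forall>x y z. C (x + y - z) = C x + C y - C z)"
  then have *: "C (x + y) = C x + C y - C 0" "bij C" for x y
    by (metis diff_zero)+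
  show "affine_bij C" unfolding affine_bij_def additive_def
    by (simp add: *(2)) (simp add: *(1))
qed (use affine_bij_add_diff in \<open>auto simp: affine_bij_def\<close>)

lemma affine_bij_comp: "affine_bij C \<Longrightarrow> affine_bij D \<Longrightarrow> affine_bij (C \<circ> D)"
  by (auto simp: affine_bij_iff bij_comp)

lemma affine_bij_inv:
  assumes "affine_bij C" shows "affine_bij (inv C)"
proof -
  have b: "bij C" and e: "\<And>x y z. C (x + y - z) = C x + C y - C z"
    using assms by (auto simp: affine_bij_iff)
  have "inv C (x + y - z) = inv C x + inv C y - inv C z" for x y z
    using e[of "inv C x" "inv C y" "inv C z"] b
    by (metis bij_inv_eq_iff)
  then show ?thesis using b by (simp add: affine_bij_iff bij_imp_bij_inv)
qed

lemma affine_permutation2_imp_affine_bij: "affine_permutation2 C \<Longrightarrow> affine_bij C"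
  unfolding affine_permutation2_def
  by (auto intro!: affine_bijI simp: additive_def Vector_Spaces.linear_iff)

lemma linear_part_comp:
  assumes "affine_bij C"
  shows "linear_part (C \<circ> D) z = linear_part C (linear_part D z)"
  using affine_bij_add_diff[OF assms, of "D z" 0 "D 0"] by simp

section \<open>Quadratic APN functions and their translation groups\<close>

definition polar :: "('v::ab_group_add \<Rightarrow> 'w::ab_group_add) \<Rightarrow> 'v \<Rightarrow> 'v \<Rightarrow> 'w" where
  "polar f x y = f (x + y) + f x + f y"

text \<open>\<open>polar_add\<close> makes \<open>f\<close> quadratic, and \<open>polar_eq_0\<close>
  is the APN property read off the polarization. \<open>polar_span\<close> is the dual form of
  saying that the values of the polarization span the space. The threshold 16 in
  \<open>card_gt\<close> is what the rank comparison in \<open>translations_eqI\<close>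
  requires.\<close>

locale quadratic_apn =
  fixes f :: "'v::{finite, ab_group_add} \<Rightarrow> 'v"
  assumes two: "\<And>x::'v. x + x = 0"
    and zero: "f 0 = 0"
    and polar_add: "\<And>x y z. polar f (x + y) z = polar f x z + polar f y z"
    and polar_eq_0: "\<And>x a. polar f x a = 0 \<Longrightarrow> a \<noteq> 0 \<Longrightarrow> x = 0 \<or> x = a"
    and polar_span: "\<And>S :: 'v \<Rightarrow> 'v. additive S \<Longrightarrow> (\<And>x y. S (polar f x y) = 0) \<Longrightarrow> S y = 0"
    and card_gt: "CARD('v) > 16"
begin

lemma minus_eq [simp]: "- x = (x::'v)"
  using two[of x] by (simp add: eq_neg_iff_add_eq_0[symmetric])

lemma diff_eq [simp]: "x - y = x + (y::'v)"
  by (metis diff_conv_add_uminus minus_eq)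

lemma two_left [simp]: "x + (x + y) = (y::'v)"
  by (simp add: add.assoc[symmetric] two)

lemma polar_commute: "polar f x y = polar f y x"
  by (simp add: polar_def ac_simps)

lemma polar_add_right: "polar f x (y + z) = polar f x y + polar f x z"
  by (metis polar_add polar_commute)

lemma polar_0 [simp]: "polar f 0 x = 0" "polar f x 0 = 0"
  by (simp_all add: polar_def zero two)

lemma polar_self [simp]: "polar f x x = 0"
  by (simp add: polar_def zero two)

lemma f_add: "f (x + y) = f x + f y + polar f x y"
  by (simp add: polar_def ac_simps two)

text \<open>The affine map that extends \<open>(x, f x) \<mapsto> (x + a, f (x + a))\<close> from
  the graph to the whole space.\<close>

definition tr :: "'v \<Rightarrow> 'v \<times> 'v \<Rightarrow> 'v \<times> 'v" where
  "tr a = (\<lambda>(x, y). (x + a, y + polar f x a + f a))"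

lemma tr_apply: "tr a (x, y) = (x + a, y + polar f x a + f a)"
  by (simp add: tr_def)

lemma tr_tr: "tr a (tr b p) = tr (a + b) p"
  by (cases p) (simp add: tr_apply f_add polar_add_right polar_add polar_commute[of b a] ac_simps)

lemma tr_0 [simp]: "tr 0 p = p"
  by (cases p) (simp add: tr_apply zero)

lemma bij_tr: "bij (tr a)"
  by (rule involuntory_imp_bij) (simp add: tr_tr two)

lemma inj_tr: "inj tr"
  by (rule injI) (metis add_0 prod.inject tr_apply)

lemma tr_graph: "tr a ` fun_graph f = fun_graph f"
proof
  show *: "tr a ` fun_graph f \<subseteq> fun_graph f" for a
    by (auto simp: fun_graph_def tr_apply f_add ac_simps)
  show "fun_graph f \<subseteq> tr a ` fun_graph f"
  proof
    fix p assume "p \<in> fun_graph f"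
    then have "tr a p \<in> fun_graph f" using * by blast
    moreover have "p = tr a (tr a p)" by (simp add: tr_tr two)
    ultimately show "p \<in> tr a ` fun_graph f" by blast
  qed
qed

lemma affine_bij_tr: "affine_bij (tr a)"
  by (rule affine_bijI[of _ "\<lambda>(x, y). (x, y + polar f x a)" "(a, f a)"])
     (auto simp: bij_tr additive_def tr_apply polar_add ac_simps)

lemma linear_part_tr: "linear_part (tr a) (x, y) = (x, y + polar f x a)"
  by (simp add: tr_apply minus_prod_def zero_prod_def ac_simps two)

text \<open>By \<open>polar_span\<close> the graph affinely spans the whole space.\<close>

lemma affine_bij_eqI:
  assumes C: "affine_bij C" "affine_bij D" and eq: "\<And>p. p \<in> fun_graph f \<Longrightarrow> C p = D p"
  shows "C = D"
proof -
  let ?S = "\<lambda>z. linear_part C z - linear_part D z"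
  interpret c: additive "linear_part C" using C by (simp add: affine_bij_def)
  interpret d: additive "linear_part D" using C by (simp add: affine_bij_def)
  interpret s: additive ?S
    by unfold_locales (subst c.add, subst d.add, simp)
  have C0: "C 0 = D 0" using eq[of 0] zero by (auto simp: fun_graph_def zero_prod_def)
  have graph: "?S (x, f x) = 0" for x
    using eq[of "(x, f x)"] C0 by (auto simp: fun_graph_def)
  \<comment> \<open>Three graph points combine to a vertical vector, so the difference of the linear
    parts vanishes on every \<open>(0, polar f x y)\<close>.\<close>
  have "?S (0, polar f x y) = 0" for x y
  proof -
    have "(0, polar f x y) = (x + y, f (x + y)) - (x, f x) - (y, f y)"
      by (simp add: polar_def ac_simps two)
    then show ?thesis by (simp only: s.diff graph) simp
  qed
  moreover have "additive (\<lambda>y. fst (?S (0, y)))" "additive (\<lambda>y. snd (?S (0, y)))"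
    unfolding additive_def
    by (metis s.add add_0 add_Pair fst_add, metis s.add add_0 add_Pair snd_add)
  ultimately have "fst (?S (0, y)) = 0" "snd (?S (0, y)) = 0" for y
    using polar_span[of "\<lambda>y. fst (?S (0, y))" y] polar_span[of "\<lambda>y. snd (?S (0, y))" y]
    by (auto simp: zero_prod_def)
  then have vert: "?S (0, y) = 0" for y by (metis prod_eq_iff fst_zero snd_zero)
  have "?S p = 0" for p
  proof -
    obtain x y where p: "p = (x, f x) + (0, y)"
      by (metis add_Pair add_0_right two_left surj_pair)
    show ?thesis unfolding p by (simp only: s.add graph vert add_0)
  qed
  then have "C p = D p" for p using C0 by simp
  then show ?thesis by blast
qed


section \<open>Translation groups that normalize one another\<close>

lemma add_eq_swap: "x + y = z \<Longrightarrow> x = z + (y::'v)"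
  by (auto simp: add.assoc two)

lemma two_prod: "p + p = (0::'v \<times> 'v)"
  by (cases p) (simp add: two zero_prod_def)

lemma minus_eq_prod [simp]: "- p = (p::'v \<times> 'v)"
  by (cases p) simp

lemma diff_eq_prod [simp]: "p - q = p + (q::'v \<times> 'v)"
  by (cases p; cases q) simp

lemma two_left_prod [simp]: "p + (p + q) = (q::'v \<times> 'v)"
  by (simp add: add.assoc[symmetric] two_prod)

lemma origin_graph: "0 \<in> fun_graph f"
  using zero by (auto simp: fun_graph_def zero_prod_def)

lemma even_card: "even (CARD('v))"
proof -
  obtain a :: 'v where "a \<noteq> 0"
    using card_gt by (metis (mono_tags, opaque_lifting) UNIV_eq_I card_1_singleton_iff
        insert_iff less_numeral_extra(4) not_numeral_less_one One_nat_def)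
  then show ?thesis
    by (intro even_card_involution[where i = "\<lambda>x. x + a"]) (auto simp: add.assoc two)
qed

text \<open>Polarization against a nonzero \<open>c\<close> vanishes only at 0 and \<open>c\<close>,
  so one \<open>c\<close> outside \<open>{0, p}\<close> decides.\<close>

lemma polar_eq_0_all:
  assumes "\<And>c. polar f p c = 0"
  shows "p = 0"
proof (rule ccontr)
  assume "p \<noteq> 0"
  have "card {0, p} < CARD('v)" using card_gt by (simp add: card_insert_if)
  then obtain c where "c \<notin> {0, p}" by (metis UNIV_eq_I less_irrefl)
  then show False using polar_eq_0[OF assms, of c] \<open>p \<noteq> 0\<close> by auto
qed

text \<open>Since each \<open>t a\<close> is an involution, \<open>norm\<close> says that the group
  \<open>range t\<close> normalizes \<open>range tr\<close>. The two groups share a nontrivial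
  element \<open>tr b\<close>, which forces the linear parts of \<open>t a\<close> to move first
  coordinates at most by \<open>b\<close>; a rank count removes this last possibility.\<close>

lemma translations_eqI:
  assumes g: "quadratic_apn g" and D: "affine_bij D" "D ` fun_graph g = fun_graph f"
    and t_def: "\<And>a. t a = D \<circ> quadratic_apn.tr g a \<circ> inv D"
    and norm: "\<And>a c. t a \<circ> tr c \<circ> t a \<in> range tr"
  shows "range t = range tr"
proof -
  interpret g: quadratic_apn g by fact
  have bD: "bij D" using D by (simp add: affine_bij_def)
  have invD [simp]: "inv D (D p) = p" "D (inv D p) = p" for p
    using bD by (auto simp: bij_is_inj bij_is_surj surj_f_inv_f)
  have t_D: "t a (D p) = D (g.tr a p)" for a p by (simp add: t_def)
  have t_t: "t a (t b p) = t (a + b) p" for a b p by (simp add: t_def g.tr_tr)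
  have t_0 [simp]: "t 0 p = p" for p by (simp add: t_def)
  have t_t_same [simp]: "t a (t a p) = p" for a p by (simp add: t_t two)
  have aff_t: "affine_bij (t a)" for a
    unfolding t_def by (intro affine_bij_comp affine_bij_inv D g.affine_bij_tr)
  have t_graph: "t a ` fun_graph f = fun_graph f" for a
  proof -
    have "t a ` D ` fun_graph g = D ` g.tr a ` fun_graph g" by (simp add: image_image t_D)
    then show ?thesis by (simp only: D(2) g.tr_graph)
  qed
  have inj_t: "inj t"
  proof (rule injI)
    fix a b assume "t a = t b"
    then have "t a (D p) = t b (D p)" for p by simp
    then have "g.tr a = g.tr b" unfolding t_D using bD by (auto simp: bij_def inj_eq)
    then show "a = b" using g.inj_tr by (simp add: inj_eq)
  qed
  have regular: "\<exists>a. p = t a q" if "p \<in> fun_graph f" "q \<in> fun_graph f" for p q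
  proof -
    have "p \<in> D ` fun_graph g" "q \<in> D ` fun_graph g" using that by (simp_all only: D(2))
    then obtain x y where "p = D (x, g x)" "q = D (y, g y)" unfolding fun_graph_def by blast
    then have "p = t (x + y) q"
      by (simp add: t_D g.tr_apply g.f_add g.polar_add_right g.polar_commute[of y x] ac_simps two)
    then show ?thesis by blast
  qed

  text \<open>A 2-group acting on the \<open>CARD('v) - 1\<close> nontrivial translations has a fixed point.\<close>
  obtain b where b: "b \<noteq> 0" "\<And>a. t a \<circ> tr b \<circ> t a = tr b"
  proof -
    let ?X = "range tr - {id}" and ?\<Phi> = "\<lambda>a s. t a \<circ> s \<circ> t a"
    have id: "id \<in> range tr" by (rule range_eqI[of _ _ 0]) auto
    have "card ?X = CARD('v) - 1"
      using id by (simp add: card_image inj_tr)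
    moreover have "CARD('v) \<noteq> 0" using card_gt by simp
    ultimately have "odd (card ?X)" using even_card by simp
    moreover have "even (card {s \<in> ?X. \<exists>a. ?\<Phi> a s \<noteq> s})"
    proof (rule even_card_nonfixed)
      fix a s assume s: "s \<in> ?X"
      have "s = id" if "?\<Phi> a s = id"
      proof
        fix p
        have "?\<Phi> a s (t a p) = t a p" using that by simp
        then have "t a (t a (s p)) = p" by simp
        then show "s p = id p" by simp
      qed
      then show "?\<Phi> a s \<in> ?X" using norm s by auto
    qed (auto simp: two t_t fun_eq_iff add.commute)
    ultimately have "{s \<in> ?X. \<exists>a. ?\<Phi> a s \<noteq> s} \<noteq> ?X" by metis
    then obtain s where "s \<in> ?X" "\<And>a. ?\<Phi> a s = s" by blast
    then show ?thesis using that tr_0 by (metis DiffE eq_id_iff rangeE singletonI)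
  qed
  \<comment> \<open>Choose the element of \<open>range t\<close> that moves the origin as
    \<open>tr b\<close> does. Both commute with the group \<open>range t\<close>, which is
    transitive on the graph, so they agree on the graph and hence everywhere.\<close>
  obtain a0 where a0: "tr b 0 = t a0 0"
    using regular[OF _ origin_graph] tr_graph origin_graph by blast
  have tr_b: "tr b = t a0"
  proof (rule affine_bij_eqI[OF affine_bij_tr aff_t])
    fix p assume "p \<in> fun_graph f"
    then obtain c where p: "p = t c 0" using regular origin_graph by blast
    have "tr b (t c 0) = (t c \<circ> tr b \<circ> t c) (t c 0)" by (simp only: b)
    also have "\<dots> = t c (t a0 0)" by (simp add: a0)
    finally show "tr b p = t a0 p" by (simp add: p t_t add.commute)
  qed

  have lin_t: "linear_part (t a) (linear_part D p) = linear_part D (linear_part (g.tr a) p)" for a p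
  proof -
    have "t a \<circ> D = D \<circ> g.tr a" by (auto simp: t_D)
    then show ?thesis
      using linear_part_comp[OF aff_t, of a D p] linear_part_comp[OF D(1), of "g.tr a" p] by simp
  qed
  have surjD: "\<exists>q. p = linear_part D q" for p
  proof -
    have "p = linear_part D (inv D (p + D 0))" by simp (metis add.assoc add.right_neutral two_prod)
    then show ?thesis by blast
  qed
  interpret D: additive "linear_part D" using D by (simp add: affine_bij_def)
  \<comment> \<open>The linear part of every \<open>t a\<close> fixes the image of the vertical
    space under the linear part of \<open>D\<close> pointwise. For \<open>tr b = t a0\<close> this
    makes first coordinates orthogonal to \<open>b\<close>, leaving only 0 and
    \<open>b\<close>.\<close>
  have vert: "fst (linear_part D (0, y)) \<in> {0, b}" for y
  proof -
    obtain p q where pq: "linear_part D (0, y) = (p, q)" by fastforce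
    have "linear_part (tr b) (p, q) = (p, q)"
      using lin_t[of a0 "(0, y)"] unfolding g.linear_part_tr pq tr_b by (simp add: pq del: diff_eq_prod)
    then have "polar f p b = 0" by (simp only: linear_part_tr) simp
    then show ?thesis using polar_eq_0 b pq by auto
  qed
  have "t a \<in> range tr" for a
  proof -
    define lt where "lt = linear_part (t a)"
    interpret lt: additive lt using aff_t by (simp add: affine_bij_def lt_def)
    \<comment> \<open>\<open>N\<close> has its image in the transported vertical space, on which
      \<open>lt\<close> is the identity, so \<open>N\<close> squares to zero.\<close>
    define N where "N p = lt p + p" for p
    have N_D: "\<exists>y. N p = linear_part D (0, y)" for p
    proof -
      obtain x y where "p = linear_part D (x, y)" using surjD by (metis surj_pair)
      then have "N p = linear_part D (x, y + polar g x a) + linear_part D (x, y)"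
        by (simp only: N_def lt_def lin_t g.linear_part_tr)
      also have "\<dots> = linear_part D (0, polar g x a)"
        by (simp only: D.add[symmetric]) (simp add: two ac_simps)
      finally show ?thesis by blast
    qed
    have N_N: "N (N p) = 0" for p
    proof -
      obtain y where y: "N p = linear_part D (0, y)" using N_D by blast
      have "lt (N p) = N p" unfolding y lt_def lin_t g.linear_part_tr by simp
      then show ?thesis by (simp add: N_def two_prod)
    qed
    have fst_N: "fst (N p) \<in> {0, b}" for p using N_D vert by metis
    \<comment> \<open>By \<open>polar_eq_0_all\<close> the vertical space is the common fixed space
      of the linear parts of all \<open>tr c\<close>. Conjugation by \<open>t a\<close> stays among
      these maps, so \<open>lt\<close> preserves that space.\<close>
    have lt_vert: "fst (lt (0, y)) = 0" for y
    proof -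
      obtain p q where pq: "lt (0, y) = (p, q)" by fastforce
      have *: "polar f p c = 0" for c
      proof -
        obtain c' where c': "t a \<circ> tr c \<circ> t a = tr c'" using norm by blast
        have "tr c \<circ> t a = t a \<circ> tr c'"
          by (rule ext) (simp add: c'[symmetric])
        then have "linear_part (tr c) (lt (0, y)) = lt (linear_part (tr c') (0, y))"
          unfolding lt_def
          using linear_part_comp[OF affine_bij_tr, of c "t a" "(0, y)"]
            linear_part_comp[OF aff_t, of a "tr c'" "(0, y)"] by simp
        then show ?thesis unfolding linear_part_tr pq by (simp add: pq)
      qed
      then show ?thesis using polar_eq_0_all by (simp add: pq)
    qed
    define e h where "e = fst (t a 0)" and "h = snd (t a 0)"
    define A Q M where "A x = fst (lt (x, 0))" and "Q x = snd (lt (x, 0))"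
      and "M y = snd (lt (0, y))" for x y
    have M_add: "M (x + y) = M x + M y" for x y
      using lt.add[of "(0, x)" "(0, y)"] by (simp add: M_def)
    have A_add: "A (x + y) = A x + A y" for x y
      using lt.add[of "(x, 0)" "(y, 0)"] by (simp add: A_def)
    have Q_add: "Q (x + y) = Q x + Q y" for x y
      using lt.add[of "(x, 0)" "(y, 0)"] by (simp add: Q_def)
    have lt_eq: "lt (x, y) = (A x, M y + Q x)" for x y
      using lt.add[of "(0, y)" "(x, 0)"] lt_vert[of y]
      by (auto simp: A_def M_def Q_def prod_eq_iff)
    have t_eq: "t a (x, y) = (A x + e, M y + Q x + h)" for x y
    proof -
      have "t a (x, y) = lt (x, y) + t a 0" by (simp add: lt_def add.assoc two_prod)
      then show ?thesis by (simp add: lt_eq e_def h_def prod_eq_iff)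
    qed
    have f_A: "f (A x + e) = M (f x) + Q x + h" for x
    proof -
      have "t a (x, f x) \<in> fun_graph f" using t_graph[of a] by (auto simp: fun_graph_def)
      then show ?thesis by (auto simp: t_eq fun_graph_def)
    qed
    \<comment> \<open>Summing the graph condition \<open>f_A\<close> over \<open>x + y\<close>,
      \<open>x\<close>, \<open>y\<close> and 0 cancels its affine terms.\<close>
    have polar_A: "polar f (A x) (A y) = M (polar f x y)" for x y
    proof -
      have "polar f (A x) (A y) = f (A (x + y) + e) + f (A x + e) + f (A y + e) + f (A 0 + e)"
        using A_add[of 0 0]
        by (simp add: f_add A_add polar_add polar_add_right ac_simps two)
      also have "\<dots> = M (polar f x y)"
        unfolding f_A using Q_add[of 0 0] M_add[of 0 0]
        by (simp add: polar_def zero Q_add M_add ac_simps two)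
      finally show ?thesis .
    qed
    have A_cases: "A x = x \<or> A x = x + b" for x
    proof -
      have "A x + x = 0 \<or> A x + x = b" using fst_N[of "(x, 0)"] by (simp add: N_def A_def)
      then show ?thesis by (metis add_eq_swap add.commute add_0)
    qed
    have A_id: "A y = y" for y
    proof (rule ccontr)
      assume "A y \<noteq> y"
      then have Ay: "A y = y + b" using A_cases by blast
      \<comment> \<open>\<open>A\<close> moves vectors at most by \<open>b\<close>, so its fixed
        space \<open>H\<close> has index at most 2.\<close>
      define H where "H = {x. A x = x}"
      have "x \<in> H \<union> (+) y ` H" for x
      proof (cases "x \<in> H")
        case False
        then have "y + x \<in> H"
          using A_cases[of x] Ay by (auto simp: H_def A_add ac_simps two)
        then show ?thesis by (metis UnI2 image_eqI two_left)
      qed simp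
      then have "UNIV = H \<union> (+) y ` H" by blast
      then have "CARD('v) \<le> card H + card ((+) y ` H)" by (metis card_Un_le)
      also have "\<dots> \<le> 2 * card H" by (simp add: card_image_le)
      finally have cH: "CARD('v) \<le> 2 * card H" .
      \<comment> \<open>\<open>\<psi>\<close> is the vertical part of \<open>N\<close>, so its image
        lies in its kernel, and the square of the size of the image is at most
        \<open>CARD('v)\<close>.\<close>
      define \<psi> where "\<psi> u = M u + u" for u
      have "additive \<psi>" by (simp add: additive_def \<psi>_def M_add ac_simps)
      have "range \<psi> \<subseteq> {u. \<psi> u = 0}"
      proof -
        have "N (0, u) = (0, \<psi> u)" for u
          using A_add[of 0 0] Q_add[of 0 0] by (simp add: N_def lt_eq \<psi>_def)
        moreover have "N (0, \<psi> u) = 0" for u using N_N[of "(0, u)"] calculation by simp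
        ultimately show ?thesis by (auto simp: zero_prod_def)
      qed
      then have "card (range \<psi>) * card (range \<psi>) \<le> card (range \<psi>) * card {u. \<psi> u = 0}"
        by (intro mult_left_mono card_mono) auto
      also have "\<dots> \<le> CARD('v)" by (rule card_range_mult_card_kernel_le) fact
      finally have sq: "card (range \<psi>) * card (range \<psi>) \<le> CARD('v)" .
      \<comment> \<open>For \<open>x\<close> in \<open>H\<close>, comparing
        \<open>polar f x (A y)\<close> with \<open>polar f x y\<close> exhibits
        \<open>polar f x b\<close> as a value of \<open>\<psi>\<close>. Polarization against
        \<open>b\<close> is at most two-to-one, so the image of \<open>\<psi>\<close> has at least
        \<open>CARD('v) / 4\<close> elements.\<close>
      let ?I = "(\<lambda>x. polar f x b) ` H"
      have "?I \<subseteq> range \<psi>"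
      proof
        fix v assume "v \<in> ?I"
        then obtain x where x: "A x = x" "v = polar f x b" by (auto simp: H_def)
        have "v = \<psi> (polar f x y)"
          using polar_A[of x y] x Ay
            add_eq_swap[of "polar f x b" "polar f x y" "M (polar f x y)"]
          by (simp add: \<psi>_def polar_add_right add.commute)
        then show "v \<in> range \<psi>" by blast
      qed
      then have cI: "card ?I \<le> card (range \<psi>)" by (simp add: card_mono)
      have "H \<subseteq> (\<Union>v \<in> ?I. {x. polar f x b = v})" by blast
      then have "card H \<le> card (\<Union>v \<in> ?I. {x. polar f x b = v})" by (simp add: card_mono)
      also have "\<dots> \<le> (\<Sum>v \<in> ?I. card {x. polar f x b = v})" by (rule card_UN_le) simp
      also have "\<dots> \<le> (\<Sum>v \<in> ?I. 2)"
      proof (rule sum_mono)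
        fix v assume "v \<in> ?I"
        then obtain x0 where x0: "polar f x0 b = v" by blast
        have "{x. polar f x b = v} \<subseteq> {x0, x0 + b}"
        proof
          fix x assume "x \<in> {x. polar f x b = v}"
          then have "polar f (x + x0) b = 0" using x0 by (simp add: polar_add two)
          then have "x + x0 = 0 \<or> x + x0 = b" using polar_eq_0 b by blast
          then show "x \<in> {x0, x0 + b}" by (metis add_eq_swap add.commute add_0 insert_iff)
        qed
        then have "card {x. polar f x b = v} \<le> card {x0, x0 + b}" by (simp add: card_mono)
        also have "\<dots> \<le> 2" by (simp add: card_insert_if)
        finally show "card {x. polar f x b = v} \<le> 2" .
      qed
      finally have "card H \<le> 2 * card ?I" by simp
      then have c4: "CARD('v) \<le> 4 * card (range \<psi>)" using cH cI by linarith
      then have "CARD('v) * CARD('v) \<le> (4 * card (range \<psi>)) * (4 * card (range \<psi>))"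
        by (intro mult_mono) auto
      also have "\<dots> \<le> 16 * CARD('v)" using sq by simp
      finally show False using card_gt by simp
    qed
    \<comment> \<open>With \<open>A\<close> the identity, \<open>M\<close> fixes every value of the
      polarization, and these values span.\<close>
    have M_id: "M y = y" for y
    proof -
      have "additive (\<lambda>u. M u + u)" by (simp add: additive_def M_add ac_simps)
      then have "M y + y = 0"
        by (rule polar_span) (simp add: polar_A[symmetric] A_id two)
      then show ?thesis using add_eq_swap by fastforce
    qed
    have "t a = tr e"
    proof
      fix p show "t a p = tr e p"
      proof (cases p)
        case (Pair x y)
        have "Q x + h = polar f x e + f e"
          using f_A[of x] unfolding A_id M_id f_add by (simp add: ac_simps)
        then show ?thesis by (simp add: Pair t_eq tr_apply A_id M_id add.assoc)
      qed
    qed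
    then show ?thesis by blast
  qed
  then have "range t \<subseteq> range tr" by blast
  moreover have "card (range t) = card (range tr)" by (simp add: card_image inj_t inj_tr)
  ultimately show ?thesis by (simp add: card_subset_eq)
qed


text \<open>Two solutions differ by an element of \<open>{0, a}\<close>, the kernel of polarization
  against \<open>a\<close>.\<close>

lemma apn_f: "apn f"
  unfolding apn_def
proof (intro allI impI)
  fix b a :: 'v assume "a \<noteq> 0"
  let ?X = "{x. f (x + a) + f x = b}"
  show "card ?X \<in> {0, 2}"
  proof (cases "?X = {}")
    case True
    then show ?thesis by (simp only: card.empty) simp
  next
    case False
    then obtain x0 where x0: "x0 \<in> ?X" by blast
    have mem: "x \<in> ?X \<longleftrightarrow> polar f x a = b + f a" for x
    proof -
      have "f (x + a) + f x = polar f x a + f a" unfolding f_add[of x a] by (simp add: ac_simps)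
      then show ?thesis by (auto simp: add.assoc two dest: add_eq_swap)
    qed
    have "?X = {x0, x0 + a}"
    proof (intro subset_antisym subsetI)
      fix x assume "x \<in> ?X"
      then have "polar f (x + x0) a = 0" using x0 by (simp add: mem polar_add two del: mem_Collect_eq)
      then have "x + x0 = 0 \<or> x + x0 = a" using polar_eq_0 \<open>a \<noteq> 0\<close> by blast
      then show "x \<in> {x0, x0 + a}" by (metis add_eq_swap add.commute add_0 insert_iff)
    next
      fix x assume "x \<in> {x0, x0 + a}"
      then show "x \<in> ?X" using x0 by (auto simp: mem polar_add simp del: mem_Collect_eq)
    qed
    moreover have "x0 \<noteq> x0 + a" using \<open>a \<noteq> 0\<close> by simp
    ultimately show ?thesis by simp
  qed
qed

section \<open>Conjugates of the translation group under graph automorphisms\<close>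

definition graph_aut :: "('v \<times> 'v \<Rightarrow> 'v \<times> 'v) set" where
  "graph_aut = {C. affine_bij C \<and> C ` fun_graph f = fun_graph f}"

definition conj_tr :: "('v \<times> 'v \<Rightarrow> 'v \<times> 'v) \<Rightarrow> ('v \<times> 'v \<Rightarrow> 'v \<times> 'v) set" where
  "conj_tr C = range (\<lambda>a. C \<circ> tr a \<circ> inv C)"

text \<open>Conjugation by \<open>inv C\<close> carries \<open>conj_tr C\<close> back to
  \<open>range tr\<close> and keeps the graph, so \<open>translations_eqI\<close> applies to the
  transported group.\<close>

lemma conj_tr_fixed:
  assumes h: "quadratic_apn h" and D: "affine_bij D" "D ` fun_graph h = fun_graph f"
    and u_def: "\<And>a. u a = D \<circ> quadratic_apn.tr h a \<circ> inv D"
    and C: "C \<in> graph_aut"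
    and fixed: "\<And>a. (\<lambda>s. u a \<circ> s \<circ> u a) ` conj_tr C = conj_tr C"
  shows "range u = conj_tr C"
proof -
  have aff: "affine_bij C" and graph: "C ` fun_graph f = fun_graph f"
    using C by (auto simp: graph_aut_def)
  then have bC: "bij C" by (simp add: affine_bij_def)
  have invC [simp]: "inv C (C p) = p" "C (inv C p) = p" for p
    using bC by (auto simp: bij_is_inj bij_is_surj surj_f_inv_f)
  have inv_comp: "inv (inv C \<circ> D) = inv D \<circ> C"
    using D aff by (simp add: affine_bij_def o_inv_distrib bij_imp_bij_inv inv_inv_eq)
  define t where "t a = (inv C \<circ> D) \<circ> quadratic_apn.tr h a \<circ> inv (inv C \<circ> D)" for a
  have t_eq: "t a = inv C \<circ> u a \<circ> C" for a
    by (simp add: t_def u_def inv_comp comp_assoc)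
  have "range t = range tr"
  proof (rule translations_eqI[OF h, of "inv C \<circ> D"])
    show "affine_bij (inv C \<circ> D)" using D aff by (simp add: affine_bij_comp affine_bij_inv)
    have "inv C ` C ` fun_graph f = fun_graph f" by (simp add: image_image)
    then show "(inv C \<circ> D) ` fun_graph h = fun_graph f"
      using D(2) graph by (metis image_comp)
    fix a c
    have "u a \<circ> (C \<circ> tr c \<circ> inv C) \<circ> u a \<in> conj_tr C"
      using fixed[of a] by (auto simp: conj_tr_def)
    then obtain c' where c': "u a \<circ> (C \<circ> tr c \<circ> inv C) \<circ> u a = C \<circ> tr c' \<circ> inv C"
      by (auto simp: conj_tr_def)
    have "(t a \<circ> tr c \<circ> t a) p = tr c' p" for p
      using fun_cong[OF c', of "C p"] by (simp add: t_eq)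
    then show "t a \<circ> tr c \<circ> t a \<in> range tr" by blast
  qed (rule t_def)
  then have "(\<lambda>s. C \<circ> s \<circ> inv C) ` range t = (\<lambda>s. C \<circ> s \<circ> inv C) ` range tr" by simp
  moreover have "C \<circ> t a \<circ> inv C = u a" for a by (auto simp: t_eq)
  ultimately show ?thesis by (simp add: image_image conj_tr_def)
qed

text \<open>Each \<open>u a\<close> is itself a graph automorphism, so conjugation by these
  involutions is an action of an elementary abelian 2-group on the set of conjugates.\<close>

lemma even_card_conj_tr_nonfixed:
  assumes h: "quadratic_apn h" and D: "affine_bij D" "D ` fun_graph h = fun_graph f"
    and u_def: "\<And>a. u a = D \<circ> quadratic_apn.tr h a \<circ> inv D"
  shows "even (card {S \<in> conj_tr ` graph_aut. \<exists>a. (\<lambda>s. u a \<circ> s \<circ> u a) ` S \<noteq> S})"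
proof (rule even_card_nonfixed)
  interpret h: quadratic_apn h by fact
  have bD: "bij D" using D by (simp add: affine_bij_def)
  have invD [simp]: "inv D (D p) = p" "D (inv D p) = p" for p
    using bD by (auto simp: bij_is_inj bij_is_surj surj_f_inv_f)
  have u_u: "u a (u b p) = u (a + b) p" for a b p by (simp add: u_def h.tr_tr)
  have u_0 [simp]: "u 0 p = p" for p by (simp add: u_def)
  have u_inv: "inv (u a) = u a" for a
    by (rule inv_equality) (simp_all add: u_u two)
  have u_aut: "u a \<in> graph_aut" for a
  proof -
    have "u a (D p) = D (h.tr a p)" for p by (simp add: u_def)
    then have "u a ` D ` fun_graph h = D ` h.tr a ` fun_graph h" by (simp add: image_image)
    then have "u a ` fun_graph f = fun_graph f" by (simp only: D(2) h.tr_graph)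
    then show ?thesis
      by (simp add: graph_aut_def u_def affine_bij_comp affine_bij_inv D h.affine_bij_tr)
  qed
  show "(\<lambda>s. u a \<circ> s \<circ> u a) ` S \<in> conj_tr ` graph_aut" if "S \<in> conj_tr ` graph_aut" for a S
  proof -
    obtain C where C: "C \<in> graph_aut" "S = conj_tr C" using \<open>S \<in> _\<close> by blast
    have "inv (u a \<circ> C) = inv C \<circ> u a"
      using C u_aut[of a] by (simp add: graph_aut_def affine_bij_def o_inv_distrib u_inv)
    then have "(\<lambda>s. u a \<circ> s \<circ> u a) ` S = conj_tr (u a \<circ> C)"
      by (simp add: C conj_tr_def image_image comp_assoc)
    moreover have "u a \<circ> C \<in> graph_aut"
      using C u_aut[of a] affine_bij_comp unfolding graph_aut_def
      by (metis (mono_tags, lifting) image_comp mem_Collect_eq)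
    ultimately show ?thesis by blast
  qed
  show "(\<lambda>s. u (a + b) \<circ> s \<circ> u (a + b)) ` S = (\<lambda>s. u a \<circ> s \<circ> u a) ` (\<lambda>s. u b \<circ> s \<circ> u b) ` S" for a b S
    unfolding image_image
    by (rule image_cong[OF refl]) (auto simp: fun_eq_iff u_u add.commute)
  show "(\<lambda>s. u 0 \<circ> s \<circ> u 0) ` S = S" for S
    by (auto simp: fun_eq_iff image_iff comp_def)
qed (simp_all add: two)

text \<open>The Sylow-type count. The translation group fixes only itself among its conjugates, so
  their number is odd. The transported group of \<open>g\<close> therefore fixes some conjugate, and
  then equals it. Composing \<open>C0\<close> with the inverse of the conjugating automorphism
  matches the two translation groups.\<close>

lemma ccz_equivalent_imp_conjugate:
  assumes g: "quadratic_apn g" and C0: "affine_bij C0" "C0 ` fun_graph g = fun_graph f"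
  obtains E where "affine_bij E" "E ` fun_graph g = fun_graph f" "E 0 = 0"
    "\<And>c. \<exists>a. tr c \<circ> E = E \<circ> quadratic_apn.tr g a"
proof -
  interpret g: quadratic_apn g by fact
  define t where "t a = C0 \<circ> g.tr a \<circ> inv C0" for a
  let ?O = "conj_tr ` graph_aut"
  have id: "affine_bij id" by (simp add: affine_bij_iff)
  have self: "quadratic_apn f" by unfold_locales
  have tr_id: "tr a = id \<circ> tr a \<circ> inv id" for a by simp
  have "{S \<in> ?O. \<exists>a. (\<lambda>s. tr a \<circ> s \<circ> tr a) ` S \<noteq> S} = ?O - {range tr}"
  proof -
    have "(\<lambda>s. tr a \<circ> s \<circ> tr a) ` range tr = range tr" for a
    proof -
      have "tr a \<circ> tr c \<circ> tr a = tr c" for c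
        by (auto simp: fun_eq_iff tr_tr add.commute)
      then show ?thesis by (simp add: image_image)
    qed
    moreover have "S = range tr"
      if "S \<in> ?O" "\<And>a. (\<lambda>s. tr a \<circ> s \<circ> tr a) ` S = S" for S
      using conj_tr_fixed[OF self id _ tr_id] that by auto
    ultimately show ?thesis by blast
  qed
  then have "even (card (?O - {range tr}))"
    using even_card_conj_tr_nonfixed[OF self id _ tr_id] by simp
  moreover have "range tr \<in> ?O"
    by (rule image_eqI[of _ _ id]) (simp_all add: conj_tr_def graph_aut_def id)
  moreover have "finite ?O" by simp
  ultimately have "odd (card ?O)"
    by (metis card.remove even_Suc)
  moreover have "even (card {S \<in> ?O. \<exists>a. (\<lambda>s. t a \<circ> s \<circ> t a) ` S \<noteq> S})"
    by (rule even_card_conj_tr_nonfixed[OF g C0 t_def])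
  ultimately have "{S \<in> ?O. \<exists>a. (\<lambda>s. t a \<circ> s \<circ> t a) ` S \<noteq> S} \<noteq> ?O" by metis
  then obtain C where C: "C \<in> graph_aut" "\<And>a. (\<lambda>s. t a \<circ> s \<circ> t a) ` conj_tr C = conj_tr C"
    by blast
  have range_t: "range t = conj_tr C" by (rule conj_tr_fixed[OF g C0 t_def C])
  have aff: "affine_bij C" and graph: "C ` fun_graph f = fun_graph f"
    using C by (auto simp: graph_aut_def)
  have invC [simp]: "inv C (C p) = p" "C (inv C p) = p" for p
    using aff by (auto simp: affine_bij_def bij_is_inj bij_is_surj surj_f_inv_f)
  have invC0 [simp]: "inv C0 (C0 p) = p" for p
    using C0 by (auto simp: affine_bij_def bij_is_inj)
  define E where "E = inv C \<circ> C0"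
  have tr_E: "\<exists>a. tr c \<circ> E = E \<circ> g.tr a" for c
  proof -
    have "C \<circ> tr c \<circ> inv C \<in> range t" unfolding range_t conj_tr_def by blast
    then obtain a where a: "C \<circ> tr c \<circ> inv C = C0 \<circ> g.tr a \<circ> inv C0" by (auto simp: t_def)
    have "(tr c \<circ> E) p = (E \<circ> g.tr a) p" for p
      using arg_cong[OF fun_cong[OF a, of "C0 p"], of "inv C"] by (simp add: E_def)
    then show ?thesis by blast
  qed
  have "inv C ` C ` fun_graph f = fun_graph f" by (simp add: image_image)
  then have E_graph: "E ` fun_graph g = fun_graph f"
    using C0(2) graph unfolding E_def by (metis image_comp)
  have "E 0 \<in> fun_graph f" using E_graph g.origin_graph by blast
  \<comment> \<open>Following \<open>E\<close> by \<open>tr e\<close> returns the image of the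
    origin to the origin; the conjugation property survives because translations commute.\<close>
  then obtain e where e: "E 0 = (e, f e)" by (auto simp: fun_graph_def)
  show ?thesis
  proof
    show "affine_bij (tr e \<circ> E)"
      unfolding E_def by (intro affine_bij_comp affine_bij_tr affine_bij_inv aff C0)
    show "(tr e \<circ> E) ` fun_graph g = fun_graph f"
      using E_graph tr_graph by (metis image_comp)
    show "(tr e \<circ> E) 0 = 0" by (simp add: e tr_apply two) (simp add: zero_prod_def)
    fix c
    obtain a where "tr c \<circ> E = E \<circ> g.tr a" using tr_E by blast
    then have "tr c (E p) = E (g.tr a p)" for p by (metis comp_apply)
    then have "tr c (tr e (E p)) = tr e (E (g.tr a p))" for p
      by (metis tr_tr add.commute)
    then show "\<exists>a. tr c \<circ> (tr e \<circ> E) = tr e \<circ> E \<circ> g.tr a" by (auto simp: fun_eq_iff)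
  qed
qed

text \<open>The vertical space is the common fixed space of the linear parts of the translations, so
  the additive map \<open>E\<close> preserves it and is block triangular. \<open>L\<close> and
  \<open>M\<close> are its diagonal blocks; the remaining block contributes an additive term, which
  the polarization does not see.\<close>

theorem ccz_equivalent_imp_linear_equivalent:
  assumes g: "quadratic_apn g" and "ccz_equivalent g f"
  obtains L M where "additive L" "additive M" "bij L" "bij M"
    "\<And>x y. polar f (L x) (L y) = M (polar g x y)"
proof -
  interpret g: quadratic_apn g by fact
  obtain C0 where "affine_permutation2 C0" "C0 ` fun_graph g = fun_graph f"
    using assms by (auto simp: ccz_equivalent_def)
  then obtain E where E: "affine_bij E" "E ` fun_graph g = fun_graph f" "E 0 = 0"
    and tr_E: "\<And>c. \<exists>a. tr c \<circ> E = E \<circ> g.tr a"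
    using ccz_equivalent_imp_conjugate[OF g] affine_permutation2_imp_affine_bij by metis
  interpret E: additive E using E by (simp add: affine_bij_def)
  have inj_E: "inj E" using E by (simp add: affine_bij_def bij_is_inj)
  have vert: "fst (E (0, y)) = 0" for y
  proof (rule polar_eq_0_all)
    fix c
    obtain a where a: "tr c \<circ> E = E \<circ> g.tr a" using tr_E by blast
    obtain p q where pq: "E (0, y) = (p, q)" by fastforce
    have "linear_part (tr c) (E (0, y)) = linear_part E (linear_part (g.tr a) (0, y))"
      using linear_part_comp[OF affine_bij_tr, of c E "(0, y)"]
        linear_part_comp[OF E(1), of "g.tr a" "(0, y)"] a by (simp add: E)
    then have "(p, q + polar f p c) = (p, q)"
      unfolding g.linear_part_tr pq linear_part_tr by (simp add: E pq)
    then show "polar f (fst (E (0, y))) c = 0" by (simp add: pq)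
  qed
  define L N M where "L x = fst (E (x, 0))" and "N x = snd (E (x, 0))" and "M y = snd (E (0, y))"
    for x y
  have M_add: "M (x + y) = M x + M y" for x y
    using E.add[of "(0, x)" "(0, y)"] by (simp add: M_def)
  have L_add: "L (x + y) = L x + L y" for x y
    using E.add[of "(x, 0)" "(y, 0)"] by (simp add: L_def)
  have N_add: "N (x + y) = N x + N y" for x y
    using E.add[of "(x, 0)" "(y, 0)"] by (simp add: N_def)
  have E_eq: "E (x, y) = (L x, M y + N x)" for x y
    using E.add[of "(0, y)" "(x, 0)"] vert[of y]
    by (auto simp: L_def M_def N_def prod_eq_iff)
  have L0: "L 0 = 0" and N0: "N 0 = 0" and M0: "M 0 = 0"
    using E.zero by (simp_all add: L_def N_def M_def zero_prod_def[symmetric])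
  have f_L: "f (L x) = M (g x) + N x" for x
  proof -
    have "E (x, g x) \<in> fun_graph f" using E(2) by (auto simp: fun_graph_def)
    then show ?thesis by (auto simp: E_eq fun_graph_def)
  qed
  \<comment> \<open>If \<open>L x = 0\<close>, the graph condition makes \<open>E\<close> send the
    graph point over \<open>x\<close> to the origin, and \<open>E\<close> is injective.\<close>
  have "x = 0" if "L x = 0" for x
  proof -
    have "E (x, g x) = E 0" using f_L[of x] that E by (simp add: E_eq zero zero_prod_def)
    then show ?thesis using inj_E by (simp add: inj_eq zero_prod_def)
  qed
  then have "inj L" by (intro injI) (metis L_add add_eq_swap add_0 two)
  moreover have "y = 0" if "M y = 0" for y
  proof -
    have "E (0, y) = E 0" using that E by (simp add: E_eq L0 N0 zero_prod_def)
    then show ?thesis using inj_E by (simp add: inj_eq zero_prod_def)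
  qed
  then have "inj M" by (intro injI) (metis M_add add_eq_swap add_0 two)
  moreover have "polar f (L x) (L y) = M (polar g x y)" for x y
    by (simp add: polar_def L_add[symmetric] f_L) (simp add: L_add N_add M_add ac_simps two)
  ultimately show ?thesis
    by (intro that[of L M]) (auto simp: additive_def L_add M_add bij_def finite_UNIV_inj_surj)
qed

end

section \<open>Linearized polynomials over a finite field of characteristic 2\<close>

locale binary_field =
  fixes m :: nat and K :: "'a::{finite, field} itself"
  assumes card_field: "CARD('a) = 2 ^ m"
begin

section \<open>Characteristic 2 and Frobenius powers\<close>

lemma m_pos: "m > 0"
proof -
  have "card {0, 1::'a} \<le> CARD('a)" by (rule card_mono) auto
  then show ?thesis by (cases m) (auto simp: card_field)
qed

lemma two: "x + x = (0::'a)"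
proof -
  \<comment> \<open>Translation by 1 permutes the field, so the sum of all elements is unchanged
    when \<open>2 ^ m\<close> copies of 1 are added.\<close>
  have "(\<Sum>x\<in>UNIV. x + 1) = (\<Sum>x\<in>UNIV. x :: 'a)"
    by (rule sum.reindex_bij_witness[of _ "\<lambda>x. x - 1" "\<lambda>x. x + 1"]) auto
  then have "of_nat (2 ^ m) = (0::'a)"
    by (simp add: sum.distrib card_field)
  then have "(2::'a) = 0" by simp
  then show ?thesis by (metis mult_2 mult_zero_left)
qed

lemma two_eq_0 [simp]: "(2::'a) = 0"
  using two[of 1] by simp

lemma minus_eq [simp]: "- x = (x::'a)"
  using two[of x] by (simp add: eq_neg_iff_add_eq_0[symmetric])

lemma diff_eq [simp]: "x - y = x + (y::'a)"
  by (metis diff_conv_add_uminus minus_eq)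

lemma two_left [simp]: "x + (x + y) = (y::'a)"
  by (simp add: add.assoc[symmetric] two)

lemma add_eq_0_iff_eq [simp]: "x + y = 0 \<longleftrightarrow> x = (y::'a)"
  by (metis two two_left add.right_neutral)

lemma power_card: "x ^ (2 ^ m) = (x::'a)"
proof (cases "x = 0")
  case False
  let ?P = "\<Prod>y\<in>UNIV - {0::'a}. y"
  have "(\<Prod>y\<in>UNIV - {0}. x * y) = ?P"
    by (rule prod.reindex_bij_witness[of _ "\<lambda>y. y / x" "\<lambda>y. x * y"]) (use False in auto)
  then have "x ^ card (UNIV - {0::'a}) * ?P = ?P"
    by (simp add: prod.distrib)
  moreover have "?P \<noteq> 0" by simp
  moreover have "card (UNIV - {0::'a}) = 2 ^ m - 1" by (simp add: card_Diff_singleton card_field)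
  ultimately have "x ^ (2 ^ m - 1) = 1" by simp
  then have "x * x ^ (2 ^ m - 1) = x" by simp
  then show ?thesis by (simp flip: power_Suc)
qed (simp add: m_pos)

lemma add_power_two_power: "(x + y) ^ (2 ^ k) = x ^ (2 ^ k) + (y::'a) ^ (2 ^ k)"
proof (induction k)
  case (Suc k)
  have sq: "(u + v)\<^sup>2 = u\<^sup>2 + (v::'a)\<^sup>2" for u v
    by (simp add: power2_sum)
  have "z ^ 2 ^ Suc k = (z ^ 2 ^ k)\<^sup>2" for z :: 'a by (simp add: power_mult[symmetric] mult.commute)
  then show ?case by (simp only: Suc sq)
qed simp

text \<open>Exponents are integers read modulo \<open>m\<close>, so that \<open>fr (- i)\<close>
  inverts \<open>fr i\<close>.\<close>

definition fr :: "int \<Rightarrow> 'a \<Rightarrow> 'a" where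
  "fr i x = x ^ (2 ^ nat (i mod int m))"

lemma power_two_power_mod: "x ^ (2 ^ (k mod m)) = (x::'a) ^ (2 ^ k)"
proof -
  have "x ^ (2 ^ (r + m * n)) = x ^ (2 ^ r)" for r n
  proof (induction n)
    case (Suc n)
    have "x ^ (2 ^ (r + m * Suc n)) = (x ^ (2 ^ (r + m * n))) ^ (2 ^ m)"
      by (simp add: power_mult[symmetric] power_add[symmetric] ac_simps)
    then show ?case by (simp add: power_card Suc)
  qed simp
  from this[of "k mod m" "k div m"] show ?thesis by simp
qed

lemma fr_of_nat: "fr (int k) x = x ^ (2 ^ k)"
  unfolding fr_def by (simp add: nat_mod_distrib power_two_power_mod)

lemma fr_fr: "fr i (fr j x) = fr (i + j) x"
proof -
  let ?i = "nat (i mod int m)" and ?j = "nat (j mod int m)"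
  have "fr i (fr j x) = x ^ (2 ^ (?i + ?j))"
    by (simp add: fr_def power_mult[symmetric] power_add mult.commute)
  also have "\<dots> = x ^ (2 ^ ((?i + ?j) mod m))" by (rule power_two_power_mod[symmetric])
  also have "(?i + ?j) mod m = nat ((i + j) mod int m)"
  proof -
    have "int ((?i + ?j) mod m) = (i + j) mod int m"
      using m_pos by (simp add: zmod_int mod_simps)
    then show ?thesis by linarith
  qed
  finally show ?thesis by (simp add: fr_def)
qed

lemma fr_0 [simp]: "fr 0 x = x"
  by (simp add: fr_def)

lemma fr_zero [simp]: "fr i 0 = 0"
  by (simp add: fr_def power_0_left)

lemma fr_one [simp]: "fr i 1 = 1"
  by (simp add: fr_def)

lemma fr_add: "fr i (x + y) = fr i x + fr i y"
  by (simp add: fr_def add_power_two_power)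

lemma fr_mult: "fr i (x * y) = fr i x * fr i y"
  by (simp add: fr_def power_mult_distrib)

lemma fr_eq_iff [simp]: "fr i x = fr i y \<longleftrightarrow> x = y"
proof
  assume "fr i x = fr i y"
  then have "fr (- i) (fr i x) = fr (- i) (fr i y)" by simp
  then show "x = y" by (simp add: fr_fr)
qed simp

lemma fr_eq_0_iff [simp]: "fr i x = 0 \<longleftrightarrow> x = 0"
  by (metis fr_eq_iff fr_zero)

lemma fr_mod: "fr (i mod int m) x = fr i x"
  by (simp add: fr_def)

lemma fr_cong: "int m dvd i - j \<Longrightarrow> fr i x = fr j x"
  by (metis fr_mod mod_eq_dvd_iff)

text \<open>\<open>k\<close> is invertible modulo \<open>m\<close>, so some iterate of
  \<open>fr (int k)\<close> is \<open>fr 1\<close>, and a fixed point satisfies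
  \<open>t ^ 2 = t\<close>.\<close>

lemma fr_fixed_imp:
  assumes "coprime k m" "fr (int k) t = t"
  shows "t = 0 \<or> t = 1"
proof -
  have iter: "fr (int j * int k) t = t" for j
  proof (induction j)
    case (Suc j)
    have "fr (int (Suc j) * int k) t = fr (int j * int k) (fr (int k) t)"
      by (simp add: fr_fr algebra_simps)
    then show ?case by (simp add: assms Suc)
  qed simp
  obtain j where "[k * j = Suc 0] (mod m)"
    using assms(1) cong_solve_coprime_nat by blast
  then have "int m dvd int j * int k - 1"
    by (metis cong_iff_dvd_diff cong_int_iff mult.commute of_nat_1 of_nat_mult One_nat_def)
  then have "fr 1 t = t" using iter[of j] fr_cong by metis
  then have "t ^ 2 = t" using fr_of_nat[of 1 t] by simp
  then have "t * (t - 1) = 0" by (simp add: power2_eq_square right_diff_distrib del: diff_eq)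
  then show ?thesis by simp
qed

section \<open>Additive maps as linearized polynomials\<close>

lemma linearized_eq_0:
  assumes "\<And>x::'a. (\<Sum>i<m. c i * x ^ (2 ^ i)) = 0" "i < m"
  shows "c i = 0"
proof -
  define p where "p = (\<Sum>i<m. monom (c i) (2 ^ i))"
  have deg: "degree p < 2 ^ m"
  proof -
    have "degree p \<le> 2 ^ (m - 1)" unfolding p_def
      by (rule degree_sum_le) (auto intro!: order.trans[OF degree_monom_le] power_increasing)
    also have "\<dots> < (2::nat) ^ m" using m_pos by (intro power_strict_increasing) auto
    finally show ?thesis .
  qed
  have "poly p x = 0" for x using assms(1) by (simp add: p_def poly_sum poly_monom)
  then have "{x. poly p x = 0} = UNIV" by blast
  then have "p = 0" using deg card_poly_roots_bound[of p] card_field by force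
  moreover have "coeff p (2 ^ i) = c i"
    using assms(2) by (simp add: p_def coeff_sum if_distrib sum.delta cong: if_cong)
  ultimately show ?thesis by simp
qed

lemma vector_space_scale2: "vector_space (scale2 :: bit \<Rightarrow> 'a \<Rightarrow> 'a)"
  by (simp add: vector_space_scale2_iff two)

text \<open>The subset sums of a basis over the two-element field are distinct, so it has at most
  \<open>m\<close> elements; an additive map is determined by its values there.\<close>

lemma card_additive_le: "card {A :: 'a \<Rightarrow> 'a. additive A} \<le> (2 ^ m) ^ m"
proof -
  interpret vs: vector_space "scale2 :: bit \<Rightarrow> 'a \<Rightarrow> 'a" by (rule vector_space_scale2)
  obtain B :: "'a set" where B: "vs.independent B" "UNIV \<subseteq> vs.span B"
    using vs.maximal_independent_subset by blast
  have "inj_on (\<lambda>S. \<Sum>S) (Pow B)"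
  proof (rule inj_onI)
    fix S T assume ST: "S \<in> Pow B" "T \<in> Pow B" and eq: "\<Sum>S = \<Sum>T"
    let ?u = "\<lambda>v. (of_bool (v \<in> S) + of_bool (v \<in> T) :: bit)"
    have sub: "(\<Sum>v\<in>B. scale2 (of_bool (v \<in> X)) v) = \<Sum>X" if "X \<subseteq> B" for X
      by (rule sum.mono_neutral_cong_right) (use that in \<open>auto simp: scale2_def\<close>)
    have "(\<Sum>v\<in>B. scale2 (?u v) v) = \<Sum>S + \<Sum>T"
      using ST by (simp only: vs.scale_left_distrib sum.distrib sub Pow_iff)
    also have "\<dots> = 0" by (simp add: eq two)
    finally have "(\<Sum>v\<in>B. scale2 (?u v) v) = 0" .
    moreover have "(\<Sum>v\<in>B. scale2 (u v) v) \<noteq> 0" if "v \<in> B" "u v \<noteq> 0" for u v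
      using B(1) vs.dependent_finite[OF finite, of B] that by metis
    ultimately have "?u v = 0" if "v \<in> B" for v using that by metis
    then have "v \<in> S \<longleftrightarrow> v \<in> T" if "v \<in> B" for v using that by (fastforce split: if_splits)
    then show "S = T" using ST by blast
  qed
  then have "card (Pow B) \<le> CARD('a)" by (metis card_inj_on_le finite subset_UNIV)
  then have "card B \<le> m" by (simp add: card_Pow card_field)
  have "inj_on (\<lambda>A. restrict A B) {A :: 'a \<Rightarrow> 'a. additive A}"
  proof (rule inj_onI)
    fix A A' :: "'a \<Rightarrow> 'a" assume "A \<in> {A. additive A}" "A' \<in> {A. additive A}"
    then interpret A: additive A + A': additive A' by auto
    assume "restrict A B = restrict A' B"
    then have base: "A x = A' x" if "x \<in> B" for x using that by (metis restrict_apply')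
    have "A x = A' x" for x
    proof -
      have "x \<in> vs.span B" using B by blast
      then show ?thesis
      proof (rule vs.span_induct)
        show "vs.subspace {x. A x = A' x}"
          by (auto simp: vs.subspace_def A.add A'.add A.zero A'.zero scale2_def)
      qed (rule base)
    qed
    then show "A = A'" by blast
  qed
  then have "card {A :: 'a \<Rightarrow> 'a. additive A} \<le> card (PiE B (\<lambda>_. UNIV :: 'a set))"
    by (rule card_inj_on_le) (auto intro: finite_PiE)
  also have "\<dots> = (2 ^ m) ^ card B" by (simp add: card_PiE card_field)
  also have "\<dots> \<le> (2 ^ m) ^ m" using \<open>card B \<le> m\<close> by (intro power_increasing) auto
  finally show ?thesis .
qed

text \<open>Surjectivity by counting: distinct coefficient families give distinct additive maps by
  \<open>linearized_eq_0\<close>, and by \<open>card_additive_le\<close> there are no more additive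
  maps than families.\<close>

lemma additive_eq_linearized:
  assumes "additive (A :: 'a \<Rightarrow> 'a)"
  shows "\<exists>c. \<forall>x. A x = (\<Sum>i<m. c i * x ^ (2 ^ i))"
proof -
  let ?C = "PiE {..<m} (\<lambda>_. UNIV :: 'a set)"
  let ?F = "\<lambda>c x. \<Sum>i<m. c i * x ^ (2 ^ i)"
  have "inj_on ?F ?C"
  proof (rule inj_onI)
    fix c d assume cd: "c \<in> ?C" "d \<in> ?C" and eq: "?F c = ?F d"
    have "(\<Sum>i<m. (c i - d i) * x ^ (2 ^ i)) = 0" for x
      using fun_cong[OF eq, of x] by (simp add: left_diff_distrib sum_subtractf del: diff_eq)
    then have "c i - d i = 0" if "i < m" for i
      using linearized_eq_0[of "\<lambda>i. c i - d i"] that by blast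
    then show "c = d" using cd by (intro PiE_ext) (auto simp del: diff_eq)
  qed
  then have "card (?F ` ?C) = (2 ^ m) ^ m"
    by (simp add: card_image card_PiE card_field)
  moreover have sub: "?F ` ?C \<subseteq> {A. additive A}"
    by (simp add: image_subset_iff additive_def add_power_two_power distrib_left sum.distrib)
  ultimately have "?F ` ?C = {A. additive A}"
    using card_additive_le by (intro card_seteq) auto
  then have "A \<in> ?F ` ?C" using assms by simp
  then obtain c where "A = ?F c" by (rule imageE)
  then show ?thesis by (intro exI[of _ c] allI) (rule fun_cong)
qed

text \<open>\<open>coef A i\<close> is the coefficient of \<open>x ^ (2 ^ i)\<close> in the linearized polynomial of \<open>A\<close>, the
  exponents being read modulo \<open>m\<close>.\<close>

definition coef :: "('a \<Rightarrow> 'a) \<Rightarrow> int \<Rightarrow> 'a" where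
  "coef A i = (SOME c. \<forall>x. A x = (\<Sum>i<m. c i * x ^ (2 ^ i))) (nat (i mod int m))"

lemma sum_int_eq: "(\<Sum>i\<in>{0..<int m}. g i) = (\<Sum>i<m. g (int i))"
  by (rule sum.reindex_bij_witness[of _ int nat]) auto

lemma additive_expand:
  assumes "additive A"
  shows "A x = (\<Sum>i\<in>{0..<int m}. coef A i * fr i x)"
proof -
  define C where "C = (SOME c. \<forall>x. A x = (\<Sum>i<m. c i * x ^ (2 ^ i)))"
  have "\<forall>x. A x = (\<Sum>i<m. C i * x ^ (2 ^ i))"
    unfolding C_def by (rule someI_ex[OF additive_eq_linearized[OF assms]])
  moreover have "coef A i = C (nat (i mod int m))" for i by (simp only: coef_def C_def)
  ultimately show ?thesis by (simp add: sum_int_eq fr_of_nat nat_mod_distrib)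
qed

lemma coef_cong: "int m dvd i - j \<Longrightarrow> coef A i = coef A j"
  by (simp add: coef_def mod_eq_dvd_iff[symmetric])

text \<open>Uniqueness of the expansion; \<open>per\<close> extends it from representatives modulo
  \<open>m\<close> to all integer exponents.\<close>

lemma coefI:
  assumes A: "\<And>x. A x = (\<Sum>i\<in>{0..<int m}. c i * fr i x)"
    and per: "\<And>i j. int m dvd i - j \<Longrightarrow> c i = c j"
  shows "coef A i = c i"
proof -
  have "additive A" by (simp add: additive_def A fr_add distrib_left sum.distrib)
  then have "(\<Sum>j<m. (coef A (int j) - c (int j)) * x ^ (2 ^ j)) = 0" for x
    using A[of x] additive_expand[of A x]
    by (simp add: sum_int_eq left_diff_distrib sum_subtractf fr_of_nat del: diff_eq)
  then have "coef A (int j) - c (int j) = 0" if "j < m" for j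
    using that linearized_eq_0[of "\<lambda>j. coef A (int j) - c (int j)" j] by blast
  from this[of "nat (i mod int m)"] have "coef A (i mod int m) = c (i mod int m)"
    using m_pos by (simp del: diff_eq add: nat_less_iff)
  moreover have "int m dvd i mod int m - i" by (simp add: mod_eq_dvd_iff[symmetric])
  ultimately show ?thesis using coef_cong per by metis
qed

lemma sum_shift:
  fixes g :: "int \<Rightarrow> 'a"
  assumes per: "\<And>i j. int m dvd i - j \<Longrightarrow> g i = g j"
  shows "(\<Sum>i\<in>{0..<int m}. g (i + a)) = (\<Sum>i\<in>{0..<int m}. g i)"
proof (rule sum.reindex_bij_witness[of _ "\<lambda>i. (i - a) mod int m" "\<lambda>i. (i + a) mod int m"])
  fix i assume "i \<in> {0..<int m}"
  then show "((i + a) mod int m - a) mod int m = i" "((i - a) mod int m + a) mod int m = i"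
    by (simp_all add: mod_simps)
  show "g ((i + a) mod int m) = g (i + a)"
    by (rule per) (simp add: mod_eq_dvd_iff[symmetric])
qed (use m_pos in auto)

lemma coef_twist:
  assumes R: "additive R"
  shows "coef (\<lambda>x. R (fr a x * u)) i = coef R (i - a) * fr (i - a) u"
proof (rule coefI)
  fix x
  have "R (fr a x * u) = (\<Sum>i\<in>{0..<int m}. coef R ((i + a) - a) * fr ((i + a) - a) u * fr (i + a) x)"
    unfolding additive_expand[OF R, of "fr a x * u"] by (simp add: fr_mult fr_fr ac_simps)
  also have "\<dots> = (\<Sum>i\<in>{0..<int m}. coef R (i - a) * fr (i - a) u * fr i x)"
    by (rule sum_shift) (auto intro!: arg_cong2[where f = "(*)"] coef_cong fr_cong)
  finally show "R (fr a x * u) = (\<Sum>i\<in>{0..<int m}. coef R (i - a) * fr (i - a) u * fr i x)" .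
qed (auto intro!: arg_cong2[where f = "(*)"] coef_cong fr_cong)

lemma coef_add:
  assumes "additive A" "additive B"
  shows "coef (\<lambda>x. A x + B x) i = coef A i + coef B i"
proof (rule coefI)
  fix x
  show "A x + B x = (\<Sum>i\<in>{0..<int m}. (coef A i + coef B i) * fr i x)"
    by (simp add: additive_expand[OF assms(1), of x] additive_expand[OF assms(2), of x]
        distrib_right sum.distrib)
qed (metis coef_cong)

lemma coef_cmult:
  assumes "additive A"
  shows "coef (\<lambda>x. A x * u) i = coef A i * u"
proof (rule coefI)
  fix x
  show "A x * u = (\<Sum>i\<in>{0..<int m}. coef A i * u * fr i x)"
    unfolding additive_expand[OF assms, of x] sum_distrib_right
    by (rule sum.cong) (simp_all only: mult.assoc mult.commute mult.left_commute)
qed (metis coef_cong)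

lemma additive_fr: "additive (fr a)"
  by (simp add: additive_def fr_add)

lemma coef_id: "coef (\<lambda>x. x) i = of_bool (int m dvd i)"
proof (rule coefI)
  fix x
  have "(\<Sum>i\<in>{0..<int m}. of_bool (int m dvd i) * fr i x) = (\<Sum>i\<in>{0}. of_bool (int m dvd i) * fr i x)"
    using m_pos by (intro sum.mono_neutral_right) (auto simp: zdvd_not_zless)
  then show "x = (\<Sum>i\<in>{0..<int m}. of_bool (int m dvd i) * fr i x)" by simp
next
  fix i j assume "int m dvd i - j"
  then have "int m dvd i \<longleftrightarrow> int m dvd j" by (metis dvd_add_right_iff diff_add_cancel)
  then show "of_bool (int m dvd i) = of_bool (int m dvd j)" by simp
qed

lemma coef_fr: "coef (fr a) i = of_bool (int m dvd i - a)"
  using coef_twist[of "\<lambda>x. x" a 1 i] by (simp add: additive_def coef_id)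

lemma coef_fr_comp:
  assumes A: "additive A"
  shows "coef (\<lambda>x. fr a (A x)) i = fr a (coef A (i - a))"
proof (rule coefI)
  fix x
  interpret fr: additive "fr a" by (rule additive_fr)
  have "fr a (A x) = (\<Sum>i\<in>{0..<int m}. fr a (coef A ((i + a) - a)) * fr (i + a) x)"
    by (subst additive_expand[OF A]) (simp add: fr.sum fr_mult fr_fr add.commute)
  also have "\<dots> = (\<Sum>i\<in>{0..<int m}. fr a (coef A (i - a)) * fr i x)"
    by (rule sum_shift) (auto intro!: arg_cong2[where f = "(*)"] arg_cong[where f = "fr a"] coef_cong fr_cong)
  finally show "fr a (A x) = (\<Sum>i\<in>{0..<int m}. fr a (coef A (i - a)) * fr i x)" .
qed (auto intro!: arg_cong[where f = "fr a"] coef_cong)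

section \<open>Coefficients of biadditive maps\<close>

definition biadditive :: "('a \<Rightarrow> 'a \<Rightarrow> 'a) \<Rightarrow> bool" where
  "biadditive F \<longleftrightarrow> (\<forall>y. additive (\<lambda>x. F x y)) \<and> (\<forall>x. additive (F x))"

text \<open>The coefficient of \<open>x ^ (2 ^ i) * y ^ (2 ^ j)\<close>, extracted one variable at a
  time.\<close>

definition bicoef :: "('a \<Rightarrow> 'a \<Rightarrow> 'a) \<Rightarrow> int \<Rightarrow> int \<Rightarrow> 'a" where
  "bicoef F i j = coef (\<lambda>y. coef (\<lambda>x. F x y) i) j"

lemma additive_coef:
  assumes "biadditive F"
  shows "additive (\<lambda>y. coef (\<lambda>x. F x y) i)"
proof -
  have F: "additive (\<lambda>x. F x y)" "F x (y + z) = F x y + F x z" for x y z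
    using assms by (auto simp: biadditive_def additive_def)
  show ?thesis unfolding additive_def by (simp add: F coef_add)
qed

lemma bicoef_add:
  assumes "biadditive F" "biadditive G"
  shows "bicoef (\<lambda>x y. F x y + G x y) i j = bicoef F i j + bicoef G i j"
  using assms by (simp add: bicoef_def coef_add additive_coef biadditive_def)

text \<open>The Kronecker delta on exponents modulo \<open>m\<close>, with values in the
  field.\<close>

definition kd :: "int \<Rightarrow> 'a" where
  "kd i = of_bool (int m dvd i)"

lemma kd_eq_0: "\<not> int m dvd i \<Longrightarrow> kd i = 0"
  by (simp add: kd_def)

text \<open>Every term of \<open>R\<close> preserves the gap between the two exponents, so only
  pairs with \<open>j - i\<close> congruent to \<open>b - a\<close> occur. Later coefficient
  comparisons rest on this support condition.\<close>

lemma bicoef_twist: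
  assumes R: "additive R"
  shows "bicoef (\<lambda>x y. R (fr a x * fr b y * c)) i j
    = coef R (i - a) * fr (i - a) c * kd (j - i + a - b)"
proof -
  have "coef (\<lambda>x. R (fr a x * fr b y * c)) i = fr (i - a + b) y * (coef R (i - a) * fr (i - a) c)" for y
    using coef_twist[OF R, of a "fr b y * c" i] by (simp add: fr_mult fr_fr ac_simps)
  then have "bicoef (\<lambda>x y. R (fr a x * fr b y * c)) i j
      = kd (j - (i - a + b)) * (coef R (i - a) * fr (i - a) c)"
    by (simp only: bicoef_def coef_cmult[OF additive_fr] coef_fr kd_def)
  moreover have "j - (i - a + b) = j - i + a - b" by simp
  ultimately show ?thesis by (simp only: mult.commute)
qed

lemma bicoef_left:
  assumes A: "additive A"
  shows "bicoef (\<lambda>x y. A x * fr b y * c) i j = coef A i * c * kd (j - b)"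
proof -
  have "coef (\<lambda>x. A x * fr b y * c) i = fr b y * (coef A i * c)" for y
    using coef_cmult[OF A, of "fr b y * c" i] by (simp add: ac_simps)
  then show ?thesis
    by (simp only: bicoef_def coef_cmult[OF additive_fr] coef_fr kd_def mult.commute)
qed

lemma bicoef_right:
  assumes B: "additive B"
  shows "bicoef (\<lambda>x y. fr a x * B y * c) i j = coef B j * c * kd (i - a)"
proof -
  have "coef (\<lambda>x. fr a x * B y * c) i = B y * (kd (i - a) * c)" for y
    using coef_cmult[OF additive_fr, of a "B y * c" i] by (simp add: coef_fr kd_def ac_simps)
  then show ?thesis
    by (simp only: bicoef_def coef_cmult[OF B] mult.assoc) (simp only: mult.commute)
qed

lemma biadditive_add: "biadditive F \<Longrightarrow> biadditive G \<Longrightarrow> biadditive (\<lambda>x y. F x y + G x y)"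
  by (simp add: biadditive_def additive_def ac_simps)

lemma biadditive_twist: "additive R \<Longrightarrow> biadditive (\<lambda>x y. R (fr a x * fr b y * c))"
  by (simp add: biadditive_def additive_def fr_add distrib_left distrib_right)

lemma biadditive_left: "additive A \<Longrightarrow> biadditive (\<lambda>x y. A x * fr b y * c)"
  by (simp add: biadditive_def additive_def fr_add distrib_left distrib_right)

lemma biadditive_right: "additive B \<Longrightarrow> biadditive (\<lambda>x y. fr a x * B y * c)"
  by (simp add: biadditive_def additive_def fr_add distrib_left distrib_right)

lemma additive_fr_comp: "additive A \<Longrightarrow> additive (\<lambda>x. fr a (A x))"
  by (simp add: additive_def fr_add)

lemma additive_eq_0I:
  assumes "additive A" "\<And>i. coef A i = 0"
  shows "A x = 0"
  using additive_expand[OF assms(1), of x] by (simp add: assms(2))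

lemma additive_eq_monomialI:
  assumes A: "additive A" and "\<And>i. \<not> int m dvd i \<Longrightarrow> coef A i = 0"
  shows "A x = coef A 0 * x"
proof -
  have "(\<Sum>i\<in>{0..<int m}. coef A i * fr i x) = (\<Sum>i\<in>{0}. coef A i * fr i x)"
    using m_pos assms(2) by (intro sum.mono_neutral_right) (auto simp: zdvd_not_zless)
  then show ?thesis using additive_expand[OF A, of x] by simp
qed


section \<open>Equivalence of biprojective alternating maps\<close>

text \<open>The polarization of \<open>(x, y) \<mapsto> (x ^ (q + 1) + x * y ^ q + \<gamma> * y ^ (q + 1), x * y ^ (q\<^sup>2))\<close>
  with \<open>q = 2 ^ k\<close>.\<close>

definition bp :: "int \<Rightarrow> 'a \<Rightarrow> 'a \<times> 'a \<Rightarrow> 'a \<times> 'a \<Rightarrow> 'a \<times> 'a" where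
  "bp k \<gamma> = (\<lambda>(x, y) (x', y').
    (fr k x * x' + x * fr k x' + x * fr k y' + fr k y * x' + \<gamma> * (fr k y * y' + y * fr k y'),
     x * fr (2 * k) y' + fr (2 * k) y * x'))"

lemma bp_apply: "bp k \<gamma> (x, y) (x', y') =
    (fr k x * x' + x * fr k x' + x * fr k y' + fr k y * x' + \<gamma> * (fr k y * y' + y * fr k y'),
     x * fr (2 * k) y' + fr (2 * k) y * x')"
  by (simp add: bp_def)

section \<open>Derivations and scalar multiplication\<close>

definition scal :: "'a \<Rightarrow> 'a \<times> 'a \<Rightarrow> 'a \<times> 'a" where
  "scal c p = (c * fst p, c * snd p)"

text \<open>Each monomial of a component has one untwisted variable and one with the Frobenius twist
  of that component, so scalar multiplication is a derivation with a diagonal right-hand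
  side.\<close>

lemma bp_scal: "bp k \<gamma> (scal c u) w + bp k \<gamma> u (scal c w) =
  ((fr k c + c) * fst (bp k \<gamma> u w), (fr (2 * k) c + c) * snd (bp k \<gamma> u w))"
  by (cases u; cases w) (simp add: bp_apply scal_def fr_mult algebra_simps)

text \<open>The converse of \<open>bp_scal\<close>. In blocks of linearized polynomials, the
  supports of the two sides rarely meet when \<open>k\<close>, \<open>2 * k\<close> and
  \<open>3 * k\<close> are nonzero modulo \<open>m\<close>, and only equal multiples of the identity
  survive on the diagonal of \<open>P\<close>.\<close>

lemma bp_derivation_scalar:
  assumes k: "\<not> int m dvd k" "\<not> int m dvd 2 * k" "\<not> int m dvd 3 * k" and "\<gamma> \<noteq> 0"
    and P: "additive P" and R: "additive R"
    and der: "\<And>u w. bp k \<gamma> (P u) w + bp k \<gamma> u (P w) = R (bp k \<gamma> u w)"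
  shows "\<exists>c. \<forall>u. P u = scal c u"
proof -
  interpret P: additive P by fact
  interpret R: additive R by fact
  define P11 P12 P21 P22 R11 R12 R21 R22 where
    "P11 x = fst (P (x, 0))" and "P12 x = fst (P (0, x))" and
    "P21 x = snd (P (x, 0))" and "P22 x = snd (P (0, x))" and
    "R11 x = fst (R (x, 0))" and "R12 x = fst (R (0, x))" and
    "R21 x = snd (R (x, 0))" and "R22 x = snd (R (0, x))" for x
  have Px: "P (x, 0) = (P11 x, P21 x)" and Py: "P (0, x) = (P12 x, P22 x)" for x
    by (simp_all add: P11_def P12_def P21_def P22_def)
  have Peq: "P (x, y) = (P11 x + P12 y, P21 x + P22 y)" for x y
    using P.add[of "(x, 0)" "(0, y)"] by (simp add: Px Py)
  have Req: "R (x, y) = (R11 x + R12 y, R21 x + R22 y)" for x y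
    using R.add[of "(x, 0)" "(0, y)"] by (simp add: R11_def R12_def R21_def R22_def prod_eq_iff)
  have addP: "additive P11" "additive P12" "additive P21" "additive P22"
    unfolding additive_def P11_def P12_def P21_def P22_def
    by (metis P.add add_Pair fst_add snd_add add_0)+
  have addR: "additive R11" "additive R12" "additive R21" "additive R22"
    unfolding additive_def R11_def R12_def R21_def R22_def
    by (metis R.add add_Pair fst_add snd_add add_0)+
  note addPf = addP[THEN additive_fr_comp]
  note zeros = addP[THEN additive.zero] addR[THEN additive.zero]
  note rules = bicoef_add biadditive_add
    addR[THEN bicoef_twist] addR[THEN biadditive_twist]
    addP[THEN bicoef_left] addP[THEN biadditive_left]
    addP[THEN bicoef_right] addP[THEN biadditive_right]
    addPf[THEN bicoef_left] addPf[THEN biadditive_left]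
    addPf[THEN bicoef_right] addPf[THEN biadditive_right]
    addP[THEN coef_fr_comp]
  have split: "f (x + y) = f x + f y" if "additive f" for f :: "'a \<Rightarrow> 'a" and x y
    using that by (simp add: additive_def)
  let ?p11 = "coef P11" and ?p12 = "coef P12" and ?p21 = "coef P21" and ?p22 = "coef P22"
  let ?r11 = "coef R11" and ?r12 = "coef R12" and ?r21 = "coef R21" and ?r22 = "coef R22"

  \<comment> \<open>Equations are named after the coordinates in which the two arguments live and
    the component of the value: \<open>xx2\<close> has both arguments in the first coordinate and
    takes the second component. The factors \<open>fr 0\<close> and \<open>1\<close> put the terms
    into the shape of \<open>rules\<close>.\<close>
  have "fr (2 * k) (P21 x) * fr 0 y * 1 + fr 0 x * fr (2 * k) (P21 y) * 1
      = R21 (fr k x * fr 0 y * 1) + R21 (fr 0 x * fr k y * 1)" for x y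
    using arg_cong[OF der[of "(x, 0)" "(y, 0)"], of snd]
    by (simp add: Px Req bp_apply zeros addR[THEN split])
  then have eq: "bicoef (\<lambda>x y. fr (2 * k) (P21 x) * fr 0 y * 1 + fr 0 x * fr (2 * k) (P21 y) * 1) i j
      = bicoef (\<lambda>x y. R21 (fr k x * fr 0 y * 1) + R21 (fr 0 x * fr k y * 1)) i j" for i j
    by (simp only:)
  have xx2: "fr (2 * k) (?p21 (i - 2 * k)) * kd j + fr (2 * k) (?p21 (j - 2 * k)) * kd i
    = ?r21 (i - k) * kd (j - i + k) + ?r21 i * kd (j - i - k)" for i j
    using eq[of i j] by (simp only: rules) simp
  have "P12 x * fr (2 * k) y * 1 + fr (2 * k) x * P12 y * 1
      = R21 (fr k x * fr 0 y * \<gamma>) + R21 (fr 0 x * fr k y * \<gamma>)" for x y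
    using arg_cong[OF der[of "(0, x)" "(0, y)"], of snd]
    by (simp add: Py Req bp_apply zeros addR[THEN split] distrib_left) (simp add: ac_simps)
  then have eq: "bicoef (\<lambda>x y. P12 x * fr (2 * k) y * 1 + fr (2 * k) x * P12 y * 1) i j
      = bicoef (\<lambda>x y. R21 (fr k x * fr 0 y * \<gamma>) + R21 (fr 0 x * fr k y * \<gamma>)) i j" for i j
    by (simp only:)
  have yy2: "?p12 i * kd (j - 2 * k) + ?p12 j * kd (i - 2 * k)
    = ?r21 (i - k) * fr (i - k) \<gamma> * kd (j - i + k) + ?r21 i * fr i \<gamma> * kd (j - i - k)" for i j
    using eq[of i j] by (simp only: rules) simp
  have "P11 x * fr (2 * k) y * 1 + fr 0 x * fr (2 * k) (P22 y) * 1
      = R21 (fr 0 x * fr k y * 1) + R22 (fr 0 x * fr (2 * k) y * 1)" for x y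
    using arg_cong[OF der[of "(x, 0)" "(0, y)"], of snd]
    by (simp add: Px Py Req bp_apply zeros)
  then have eq: "bicoef (\<lambda>x y. P11 x * fr (2 * k) y * 1 + fr 0 x * fr (2 * k) (P22 y) * 1) i j
      = bicoef (\<lambda>x y. R21 (fr 0 x * fr k y * 1) + R22 (fr 0 x * fr (2 * k) y * 1)) i j" for i j
    by (simp only:)
  have xy2: "?p11 i * kd (j - 2 * k) + fr (2 * k) (?p22 (j - 2 * k)) * kd i
    = ?r21 i * kd (j - i - k) + ?r22 i * kd (j - i - 2 * k)" for i j
    using eq[of i j] by (simp only: rules) simp
  have "fr k (P11 x) * fr 0 y * 1 + P11 x * fr k y * 1 + fr k (P21 x) * fr 0 y * 1
      + fr k x * P11 y * 1 + fr 0 x * fr k (P11 y) * 1 + fr 0 x * fr k (P21 y) * 1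
      = R11 (fr k x * fr 0 y * 1) + R11 (fr 0 x * fr k y * 1)" for x y
    using arg_cong[OF der[of "(x, 0)" "(y, 0)"], of fst]
    by (simp add: Px Req bp_apply zeros addR[THEN split] ac_simps)
  then have eq: "bicoef (\<lambda>x y. fr k (P11 x) * fr 0 y * 1 + P11 x * fr k y * 1 + fr k (P21 x) * fr 0 y * 1
      + fr k x * P11 y * 1 + fr 0 x * fr k (P11 y) * 1 + fr 0 x * fr k (P21 y) * 1) i j
      = bicoef (\<lambda>x y. R11 (fr k x * fr 0 y * 1) + R11 (fr 0 x * fr k y * 1)) i j" for i j
    by (simp only:)
  have xx1: "fr k (?p11 (i - k)) * kd j + ?p11 i * kd (j - k) + fr k (?p21 (i - k)) * kd j
      + ?p11 j * kd (i - k) + fr k (?p11 (j - k)) * kd i + fr k (?p21 (j - k)) * kd i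
    = ?r11 (i - k) * kd (j - i + k) + ?r11 i * kd (j - i - k)" for i j
    using eq[of i j] by (simp only: rules) simp
  have "P11 x * fr k y * 1 + fr k (P21 x) * fr 0 y * \<gamma> + P21 x * fr k y * \<gamma>
      + fr k x * P12 y * 1 + fr 0 x * fr k (P12 y) * 1 + fr 0 x * fr k (P22 y) * 1
      = R11 (fr 0 x * fr k y * 1) + R12 (fr 0 x * fr (2 * k) y * 1)" for x y
    using arg_cong[OF der[of "(x, 0)" "(0, y)"], of fst]
    by (simp add: Px Py Req bp_apply zeros) (simp add: distrib_left ac_simps)
  then have eq: "bicoef (\<lambda>x y. P11 x * fr k y * 1 + fr k (P21 x) * fr 0 y * \<gamma> + P21 x * fr k y * \<gamma>
      + fr k x * P12 y * 1 + fr 0 x * fr k (P12 y) * 1 + fr 0 x * fr k (P22 y) * 1) i j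
      = bicoef (\<lambda>x y. R11 (fr 0 x * fr k y * 1) + R12 (fr 0 x * fr (2 * k) y * 1)) i j" for i j
    by (simp only:)
  have xy1: "?p11 i * kd (j - k) + fr k (?p21 (i - k)) * \<gamma> * kd j + ?p21 i * \<gamma> * kd (j - k)
      + ?p12 j * kd (i - k) + fr k (?p12 (j - k)) * kd i + fr k (?p22 (j - k)) * kd i
    = ?r11 i * kd (j - i - k) + ?r12 i * kd (j - i - 2 * k)" for i j
    using eq[of i j] by (simp only: rules) simp

  have kd_simps: "kd 0 = 1" "kd k = 0" "kd (2 * k) = 0" "kd (3 * k) = 0"
    "kd (- k) = 0" "kd (- (2 * k)) = 0" "kd (- (3 * k)) = 0"
    using k by (simp_all add: kd_def)
  \<comment> \<open>At \<open>j = i + k\<close> the left side of \<open>yy2\<close> vanishes unless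
    \<open>i\<close> is congruent to \<open>k\<close> or \<open>2 * k\<close>; those two
    coefficients come from \<open>xx2\<close> instead.\<close>
  have r21: "?r21 i = 0" for i
  proof (cases "int m dvd i - k \<or> int m dvd i - 2 * k")
    case True
    have "?r21 k = 0" using xx2[of k "2 * k"] by (simp add: kd_simps)
    moreover have "?r21 (2 * k) = 0" using xx2[of "2 * k" "3 * k"] by (simp add: kd_simps)
    ultimately show ?thesis using True coef_cong by metis
  next
    case False
    then show ?thesis using yy2[of i "i + k"] \<open>\<gamma> \<noteq> 0\<close> by (simp add: kd_simps kd_eq_0)
  qed
  \<comment> \<open>With \<open>R21\<close> gone, each block of \<open>P\<close> retains at most one
    exponent; the mixed equation \<open>xy1\<close> then removes those of the off-diagonal
    blocks.\<close>
  have p21: "?p21 i = 0" if "\<not> int m dvd i + 2 * k" for i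
    using xx2[of "i + 2 * k" 0] that by (simp add: kd_simps kd_eq_0 r21)
  have p12: "?p12 i = 0" if "\<not> int m dvd i - 2 * k" for i
    using yy2[of i "2 * k"] that by (simp add: kd_simps kd_eq_0 r21)
  have p11: "?p11 i = 0" if "\<not> int m dvd i" for i
    using xy2[of i "2 * k"] that by (simp add: kd_simps kd_eq_0 r21)
  have p22: "?p22 i = 0" if "\<not> int m dvd i" for i
    using xy2[of 0 "i + 2 * k"] that by (simp add: kd_simps kd_eq_0 r21)
  have "?p21 (- (2 * k)) = 0"
    using xy1[of "- (2 * k)" k] k \<open>\<gamma> \<noteq> 0\<close> by (simp add: kd_simps p11)
  then have p21: "?p21 i = 0" for i
    using p21[of i] coef_cong[of i "- (2 * k)" P21] by (cases "int m dvd i + 2 * k") auto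
  have "?p12 (2 * k) = 0"
    using xy1[of 0 "3 * k"] k by (simp add: kd_simps p22)
  then have p12: "?p12 i = 0" for i
    using p12[of i] coef_cong[of i "2 * k" P12] by (cases "int m dvd i - 2 * k") auto
  \<comment> \<open>Both diagonal coefficients are tied to the same \<open>?r11 0\<close>, hence
    equal.\<close>
  have "?p11 0 + fr k (?p22 0) = ?r11 0"
    using xy1[of 0 k] by (simp add: kd_simps p12 p21)
  moreover have "?p11 0 + fr k (?p11 0) = ?r11 0"
    using xx1[of 0 k] by (simp add: kd_simps p21)
  ultimately have eq: "?p22 0 = ?p11 0" by (metis add_left_imp_eq fr_eq_iff)
  have "P (x, y) = scal (?p11 0) (x, y)" for x y
    using additive_eq_monomialI[OF addP(1) p11, of x] additive_eq_monomialI[OF addP(4) p22, of y]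
    by (simp add: Peq additive_eq_0I[OF addP(2) p12] additive_eq_0I[OF addP(3) p21] scal_def eq)
  then show ?thesis by auto
qed

text \<open>For fixed \<open>y\<close>, compare \<open>\<sigma> (x * y)\<close> with
  \<open>\<sigma> x * \<sigma> y\<close> as functions of \<open>x\<close>: at an exponent
  \<open>s\<close> with nonzero coefficient this reads \<open>fr s y = \<sigma> y\<close>.\<close>

lemma multiplicative_additive_eq_fr:
  assumes "additive \<sigma>" "\<And>x y. \<sigma> (x * y) = \<sigma> x * \<sigma> y" "\<sigma> 1 \<noteq> 0"
  shows "\<exists>s. \<forall>x. \<sigma> x = fr s x"
proof -
  obtain s where s: "coef \<sigma> s \<noteq> 0" using additive_eq_0I assms by blast
  have "\<sigma> y = fr s y" for y
  proof -
    have "coef \<sigma> s * fr s y = coef (\<lambda>x. \<sigma> (fr 0 x * y)) s" by (subst coef_twist) (simp_all add: assms)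
    also have "\<dots> = coef \<sigma> s * \<sigma> y" by (simp add: assms coef_cmult)
    finally show ?thesis using s by simp
  qed
  then show ?thesis by blast
qed

section \<open>Semilinearity of equivalences\<close>

lemma scal_add_left: "scal (c + d) u = scal c u + scal d u"
  by (simp add: scal_def distrib_right)

lemma scal_scal: "scal c (scal d u) = scal (c * d) u"
  by (simp add: scal_def mult.assoc)

lemma additive_scal: "additive (scal c)"
  by (simp add: additive_def scal_def distrib_left)

lemma scal_right_inject: "u \<noteq> 0 \<Longrightarrow> scal c u = scal d u \<longleftrightarrow> c = d"
  by (cases u) (auto simp: scal_def zero_prod_def)

text \<open>Conjugating a scalar multiplication by \<open>L\<close> gives a derivation of
  \<open>bp l \<delta>\<close>, hence again a scalar multiplication. The induced map on scalars is
  additive and multiplicative, so it is a Frobenius power.\<close>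

lemma bp_equivalence_semilinear:
  assumes l: "\<not> int m dvd l" "\<not> int m dvd 2 * l" "\<not> int m dvd 3 * l" and "\<delta> \<noteq> 0"
    and L: "additive L" "bij L" and M: "additive M" "bij M"
    and eq: "\<And>u w. bp l \<delta> (L u) (L w) = M (bp k \<gamma> u w)"
  shows "\<exists>s. \<forall>c u. L (scal c u) = scal (fr s c) (L u)"
proof -
  interpret L: additive L by fact
  interpret M: additive M by fact
  have inv [simp]: "inv L (L u) = u" "L (inv L u) = u" "inv M (M u) = u" "M (inv M u) = u" for u
    using L(2) M(2) by (simp_all add: bij_is_inj bij_is_surj surj_f_inv_f)
  have add_inv: "additive (inv L)" "additive (inv M)"
    unfolding additive_def by (metis L.add inv(1,2), metis M.add inv(3,4))
  have "\<exists>c'. \<forall>u. L (scal c (inv L u)) = scal c' u" for c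
  proof (rule bp_derivation_scalar[OF l \<open>\<delta> \<noteq> 0\<close>])
    let ?R = "\<lambda>p. M ((fr k c + c) * fst (inv M p), (fr (2 * k) c + c) * snd (inv M p))"
    show "additive (\<lambda>u. L (scal c (inv L u)))"
      by (rule additive.intro)
        (simp only: additive.add[OF add_inv(1)] additive.add[OF additive_scal] L.add)
    show "additive ?R"
      by (rule additive.intro)
        (simp only: additive.add[OF add_inv(2)] M.add[symmetric] fst_add snd_add distrib_left add_Pair)
    fix u w
    show "bp l \<delta> (L (scal c (inv L u))) w + bp l \<delta> u (L (scal c (inv L w))) = ?R (bp l \<delta> u w)"
      using eq[of "scal c (inv L u)" "inv L w"] eq[of "inv L u" "scal c (inv L w)"]
        eq[of "inv L u" "inv L w"] by (simp add: M.add[symmetric] bp_scal)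
  qed
  then obtain \<sigma> where "\<And>c u. L (scal c (inv L u)) = scal (\<sigma> c) u" by metis
  from this[of _ "L _"] have \<sigma>: "L (scal c u) = scal (\<sigma> c) (L u)" for c u by simp
  obtain v :: "'a \<times> 'a" where v: "L v \<noteq> 0" by (metis inv(2) zero_neq_one zero_prod_def prod.inject)
  have "\<exists>s. \<forall>c. \<sigma> c = fr s c"
  proof (rule multiplicative_additive_eq_fr)
    show "additive \<sigma>" unfolding additive_def
      using \<sigma> v by (metis L.add scal_add_left scal_right_inject)
    show "\<sigma> (x * y) = \<sigma> x * \<sigma> y" for x y
      using \<sigma> v by (metis scal_scal scal_right_inject)
    have "scal (\<sigma> 1) (L v) = L v" using \<sigma>[of 1 v] by (simp add: scal_def)
    then show "\<sigma> 1 \<noteq> 0" using v by (auto simp: scal_def zero_prod_def)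
  qed
  then show ?thesis using \<sigma> by metis
qed

text \<open>\<open>norm_form k \<gamma>\<close> is the homogeneous form of \<open>X ^ (q + 1) + X + \<gamma>\<close>, so it is anisotropic
  iff this polynomial has no root.\<close>

definition norm_form :: "int \<Rightarrow> 'a \<Rightarrow> 'a \<Rightarrow> 'a \<Rightarrow> 'a" where
  "norm_form k \<gamma> a c = fr k a * a + a * fr k c + \<gamma> * (fr k c * c)"

definition rootfree :: "int \<Rightarrow> 'a \<Rightarrow> bool" where
  "rootfree k \<gamma> \<longleftrightarrow> (\<forall>z. fr k z * z + z + \<gamma> \<noteq> 0)"

lemma rootfree_nonzero: "rootfree k \<gamma> \<Longrightarrow> \<gamma> \<noteq> 0"
  by (metis rootfree_def add_0 mult_zero_right)

lemma norm_form_nonzero: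
  assumes "rootfree k \<gamma>" "a \<noteq> 0 \<or> c \<noteq> 0"
  shows "norm_form k \<gamma> a c \<noteq> 0"
proof (cases "c = 0")
  case False
  define z where "z = a / c"
  then have "a = z * c" using False by simp
  then have "norm_form k \<gamma> a c = (fr k z * z + z + \<gamma>) * (fr k c * c)"
    by (simp add: norm_form_def fr_mult algebra_simps)
  then show ?thesis using False assms by (simp add: rootfree_def)
qed (use assms in \<open>simp add: norm_form_def\<close>)


lemma coef_fr_kd: "coef (fr a) i = kd (i - a)"
  by (simp add: coef_fr kd_def)

text \<open>By semilinearity \<open>L\<close> is a 2 by 2 matrix after a Frobenius power, and
  coefficient comparison makes the matrix scalar, which leaves only \<open>\<gamma>\<close> and
  \<open>\<delta>\<close> to compare. The hypothesis \<open>range\<close> settles the sign, since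
  the coefficients only show that \<open>l\<close> is congruent to \<open>k\<close> or
  \<open>- k\<close>.\<close>

lemma bp_equivalence:
  assumes l: "\<not> int m dvd l" "\<not> int m dvd 2 * l" "\<not> int m dvd 3 * l" and "rootfree l \<delta>"
    and L: "additive L" "bij L" and M: "additive M" "bij M"
    and eq: "\<And>u w. bp l \<delta> (L u) (L w) = M (bp k \<gamma> u w)"
    and range: "int m dvd l - k \<or> int m dvd l + k \<Longrightarrow> k = l"
  shows "k = l \<and> (\<exists>s. \<delta> = fr s \<gamma>)"
proof -
  interpret L: additive L by fact
  interpret M: additive M by fact
  have "\<delta> \<noteq> 0" using \<open>rootfree l \<delta>\<close> by (rule rootfree_nonzero)
  then obtain s where s: "\<And>c u. L (scal c u) = scal (fr s c) (L u)"
    using bp_equivalence_semilinear[OF l _ L M eq] by blast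
  obtain a c b d where L1: "L (1, 0) = (a, c)" and L2: "L (0, 1) = (b, d)" by fastforce
  have Lx: "L (x, 0) = (fr s x * a, fr s x * c)" and Ly: "L (0, x) = (fr s x * b, fr s x * d)" for x
    using s[of x "(1, 0)"] s[of x "(0, 1)"] by (simp_all add: scal_def L1 L2)
  have "L (1, 0) \<noteq> L 0" "L (0, 1) \<noteq> L 0"
    using L(2) by (simp_all add: bij_is_inj inj_eq zero_prod_def)
  then have ac: "a \<noteq> 0 \<or> c \<noteq> 0" and bd: "b \<noteq> 0 \<or> d \<noteq> 0"
    unfolding L1 L2 L.zero by (auto simp: zero_prod_def)
  define M11 M12 M21 M22 where
    "M11 x = fst (M (x, 0))" and "M12 x = fst (M (0, x))" and
    "M21 x = snd (M (x, 0))" and "M22 x = snd (M (0, x))" for x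
  have Meq: "M (x, y) = (M11 x + M12 y, M21 x + M22 y)" for x y
    using M.add[of "(x, 0)" "(0, y)"] by (simp add: M11_def M12_def M21_def M22_def prod_eq_iff)
  have addM: "additive M11" "additive M12" "additive M21" "additive M22"
    unfolding additive_def M11_def M12_def M21_def M22_def
    by (metis M.add add_Pair fst_add snd_add add_0)+
  note zeros = addM[THEN additive.zero]
  note rules = bicoef_add biadditive_add
    addM[THEN bicoef_twist] addM[THEN biadditive_twist]
    bicoef_left[OF additive_fr] biadditive_left[OF additive_fr] coef_fr_kd
  have split: "f (x + y) = f x + f y" if "additive f" for f :: "'a \<Rightarrow> 'a" and x y
    using that by (simp add: additive_def)
  let ?m11 = "coef M11" and ?m12 = "coef M12" and ?m21 = "coef M21"
  let ?\<nu> = "norm_form l \<delta> a c" and ?\<nu>' = "norm_form l \<delta> b d"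

  have "M11 (fr k x * fr 0 y * 1) + M11 (fr 0 x * fr k y * 1)
      = fr (l + s) x * fr s y * ?\<nu> + fr s x * fr (l + s) y * ?\<nu>" for x y
    using arg_cong[OF eq[of "(x, 0)" "(y, 0)"], of fst]
    by (simp add: Lx Meq bp_apply zeros addM[THEN split] norm_form_def fr_mult fr_fr algebra_simps)
  then have e: "bicoef (\<lambda>x y. M11 (fr k x * fr 0 y * 1) + M11 (fr 0 x * fr k y * 1)) i j
      = bicoef (\<lambda>x y. fr (l + s) x * fr s y * ?\<nu> + fr s x * fr (l + s) y * ?\<nu>) i j" for i j
    by (simp only:)
  have xx1: "?m11 (i - k) * kd (j - i + k) + ?m11 i * kd (j - i - k)
    = kd (i - (l + s)) * ?\<nu> * kd (j - s) + kd (i - s) * ?\<nu> * kd (j - (l + s))" for i j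
    using e[of i j] by (simp only: rules) simp
  have "M21 (fr k x * fr 0 y * 1) + M21 (fr 0 x * fr k y * 1)
      = fr s x * fr (2 * l + s) y * (a * fr (2 * l) c) + fr (2 * l + s) x * fr s y * (a * fr (2 * l) c)" for x y
    using arg_cong[OF eq[of "(x, 0)" "(y, 0)"], of snd]
    by (simp add: Lx Meq bp_apply zeros addM[THEN split] fr_mult fr_fr algebra_simps)
  then have e: "bicoef (\<lambda>x y. M21 (fr k x * fr 0 y * 1) + M21 (fr 0 x * fr k y * 1)) i j
      = bicoef (\<lambda>x y. fr s x * fr (2 * l + s) y * (a * fr (2 * l) c)
         + fr (2 * l + s) x * fr s y * (a * fr (2 * l) c)) i j" for i j
    by (simp only:)
  have xx2: "?m21 (i - k) * kd (j - i + k) + ?m21 i * kd (j - i - k)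
    = kd (i - s) * (a * fr (2 * l) c) * kd (j - (2 * l + s))
      + kd (i - (2 * l + s)) * (a * fr (2 * l) c) * kd (j - s)" for i j
    using e[of i j] by (simp only: rules) simp
  have "M21 (fr k x * fr 0 y * \<gamma>) + M21 (fr 0 x * fr k y * \<gamma>)
      = fr s x * fr (2 * l + s) y * (b * fr (2 * l) d) + fr (2 * l + s) x * fr s y * (b * fr (2 * l) d)" for x y
    using arg_cong[OF eq[of "(0, x)" "(0, y)"], of snd]
    by (simp add: Ly Meq bp_apply zeros addM[THEN split] fr_mult fr_fr algebra_simps)
  then have e: "bicoef (\<lambda>x y. M21 (fr k x * fr 0 y * \<gamma>) + M21 (fr 0 x * fr k y * \<gamma>)) i j
      = bicoef (\<lambda>x y. fr s x * fr (2 * l + s) y * (b * fr (2 * l) d)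
         + fr (2 * l + s) x * fr s y * (b * fr (2 * l) d)) i j" for i j
    by (simp only:)
  have yy2: "?m21 (i - k) * fr (i - k) \<gamma> * kd (j - i + k) + ?m21 i * fr i \<gamma> * kd (j - i - k)
    = kd (i - s) * (b * fr (2 * l) d) * kd (j - (2 * l + s))
      + kd (i - (2 * l + s)) * (b * fr (2 * l) d) * kd (j - s)" for i j
    using e[of i j] by (simp only: rules) simp
  have "M11 (fr k x * fr 0 y * \<gamma>) + M11 (fr 0 x * fr k y * \<gamma>)
      = fr (l + s) x * fr s y * ?\<nu>' + fr s x * fr (l + s) y * ?\<nu>'" for x y
    using arg_cong[OF eq[of "(0, x)" "(0, y)"], of fst]
    by (simp add: Ly Meq bp_apply zeros addM[THEN split] norm_form_def fr_mult fr_fr algebra_simps)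
  then have e: "bicoef (\<lambda>x y. M11 (fr k x * fr 0 y * \<gamma>) + M11 (fr 0 x * fr k y * \<gamma>)) i j
      = bicoef (\<lambda>x y. fr (l + s) x * fr s y * ?\<nu>' + fr s x * fr (l + s) y * ?\<nu>') i j" for i j
    by (simp only:)
  have yy1: "?m11 (i - k) * fr (i - k) \<gamma> * kd (j - i + k) + ?m11 i * fr i \<gamma> * kd (j - i - k)
    = kd (i - (l + s)) * ?\<nu>' * kd (j - s) + kd (i - s) * ?\<nu>' * kd (j - (l + s))" for i j
    using e[of i j] by (simp only: rules) simp
  let ?e = "fr l a * b + fr l c * b + \<delta> * (fr l c * d)"
  let ?e' = "a * fr l b + a * fr l d + \<delta> * (c * fr l d)"
  have "M11 (fr 0 x * fr k y * 1) + M12 (fr 0 x * fr (2 * k) y * 1)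
      = fr (l + s) x * fr s y * ?e + fr s x * fr (l + s) y * ?e'" for x y
    using arg_cong[OF eq[of "(x, 0)" "(0, y)"], of fst]
    by (simp add: Lx Ly Meq bp_apply zeros fr_mult fr_fr algebra_simps)
  then have e: "bicoef (\<lambda>x y. M11 (fr 0 x * fr k y * 1) + M12 (fr 0 x * fr (2 * k) y * 1)) i j
      = bicoef (\<lambda>x y. fr (l + s) x * fr s y * ?e + fr s x * fr (l + s) y * ?e') i j" for i j
    by (simp only:)
  have xy1: "?m11 i * kd (j - i - k) + ?m12 i * kd (j - i - 2 * k)
    = kd (i - (l + s)) * ?e * kd (j - s) + kd (i - s) * ?e' * kd (j - (l + s))" for i j
    using e[of i j] by (simp only: rules) simp

  have kd_simps: "kd 0 = 1" "kd l = 0" "kd (2 * l) = 0" "kd (3 * l) = 0"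
    "kd (- l) = 0" "kd (- (2 * l)) = 0" "kd (- (3 * l)) = 0"
    using l by (simp_all add: kd_def)
  \<comment> \<open>The nonzero coefficient \<open>?\<nu>\<close> sits at exponent gap
    \<open>l\<close>, while the left side of \<open>xx1\<close> lives at gaps \<open>k\<close> and
    \<open>- k\<close>.\<close>
  have "?\<nu> \<noteq> 0" using norm_form_nonzero \<open>rootfree l \<delta>\<close> ac by blast
  then have "kd (l - k) \<noteq> 0 \<or> kd (l + k) \<noteq> 0"
    using xx1[of s "s + l"] by (auto simp: kd_simps)
  then have "k = l" using range kd_eq_0 by blast
  have m11: "?m11 s = ?\<nu>"
    using xx1[of s "s + l"] by (simp add: kd_simps \<open>k = l\<close>)
  have "a * fr (2 * l) c = 0"
    using xx2[of s "s + 2 * l"] by (simp add: kd_simps \<open>k = l\<close>)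
  then have a_c: "a = 0 \<or> c = 0" by simp
  have "b * fr (2 * l) d = 0"
    using yy2[of s "s + 2 * l"] by (simp add: kd_simps \<open>k = l\<close>)
  then have b_d: "b = 0 \<or> d = 0" by simp
  \<comment> \<open>At gap \<open>- l\<close> both left-hand terms of \<open>xy1\<close>, which live
    at gaps \<open>l\<close> and \<open>2 * l\<close>, vanish.\<close>
  have e0: "?e = 0"
    using xy1[of "s + l" s] by (simp add: kd_simps \<open>k = l\<close>)
  have "c = 0"
  proof (rule ccontr)
    assume "c \<noteq> 0"
    then have "a = 0" using a_c by simp
    then have "fr l c * (b + \<delta> * d) = 0" using e0 by (simp add: algebra_simps)
    then have "b = \<delta> * d" using \<open>c \<noteq> 0\<close> by simp
    then show False using b_d bd \<open>\<delta> \<noteq> 0\<close> by auto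
  qed
  then have "a \<noteq> 0" "b = 0" "d \<noteq> 0" using ac e0 bd by auto
  \<comment> \<open>\<open>?m11 s\<close> is computed a second time, now from
    \<open>xy1\<close>.\<close>
  then have "a * fr l d = a * fr l a"
    using xy1[of s "s + l"] \<open>c = 0\<close> m11 by (simp add: kd_simps \<open>k = l\<close> norm_form_def mult.commute)
  then have "d = a" using \<open>a \<noteq> 0\<close> by simp
  have "?\<nu> * fr s \<gamma> = ?\<nu>'"
    using yy1[of s "s + l"] m11 by (simp add: kd_simps \<open>k = l\<close>)
  then have "\<delta> = fr s \<gamma>"
    using \<open>a \<noteq> 0\<close> \<open>b = 0\<close> \<open>c = 0\<close> \<open>d = a\<close> by (simp add: norm_form_def mult.commute)
  then show ?thesis using \<open>k = l\<close> by blast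
qed

text \<open>Let \<open>q = 2 ^ k\<close>. The second component forces
  \<open>u = (r ^ (q\<^sup>2) * a, r * c)\<close>. If \<open>s = r ^ q + r\<close> were nonzero, the
  first component would produce a root of \<open>X ^ (q + 1) + X + \<gamma>\<close>. So
  \<open>r\<close> is fixed by \<open>fr (int k)\<close>, and its two possible values 0 and 1 give
  \<open>u = 0\<close> and \<open>u = w\<close>.\<close>

lemma bp_eq_0:
  assumes k: "coprime k m" and "rootfree (int k) \<gamma>"
    and zero: "bp (int k) \<gamma> u w = 0" and "w \<noteq> 0"
  shows "u = 0 \<or> u = w"
proof -
  let ?k = "int k"
  obtain x y where u: "u = (x, y)" by fastforce
  obtain a c where w: "w = (a, c)" by fastforce
  have "a \<noteq> 0 \<or> c \<noteq> 0" using \<open>w \<noteq> 0\<close> w by (auto simp: zero_prod_def)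
  have lin: "x * fr (2 * ?k) c = fr (2 * ?k) y * a"
    using zero by (simp add: u w bp_apply zero_prod_def)
  obtain r where r: "x = fr (2 * ?k) r * a" "y = r * c"
  proof (cases "a = 0")
    case True
    then have "c \<noteq> 0" "x = 0" using lin \<open>a \<noteq> 0 \<or> c \<noteq> 0\<close> by auto
    then show ?thesis using that[of "y / c"] True by simp
  next
    case False
    define t where "t = x / a"
    have "fr (2 * ?k) y = t * fr (2 * ?k) c"
      using lin False by (simp add: t_def field_simps)
    then have "fr (2 * ?k) y = fr (2 * ?k) (fr (- 2 * ?k) t * c)"
      by (simp add: fr_mult fr_fr)
    then have "y = fr (- 2 * ?k) t * c" by (simp only: fr_eq_iff)
    then show ?thesis using that[of "fr (- 2 * ?k) t"] False by (simp add: t_def fr_fr)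
  qed
  define s where "s = fr ?k r + r"
  have sum0: "fr (2 * ?k) s * (fr ?k a * a) + fr ?k s * (a * fr ?k c) + \<gamma> * (s * (fr ?k c * c)) = 0"
    using zero by (simp add: u w bp_apply zero_prod_def r s_def fr_add fr_mult fr_fr algebra_simps)
  have "s = 0"
  proof (rule ccontr)
    assume "s \<noteq> 0"
    have "c \<noteq> 0" using sum0 \<open>s \<noteq> 0\<close> \<open>a \<noteq> 0 \<or> c \<noteq> 0\<close> by auto
    \<comment> \<open>Dividing \<open>sum0\<close> by \<open>s * (fr ?k c * c)\<close> leaves
      \<open>X ^ (q + 1) + X + \<gamma>\<close> evaluated at \<open>(a / c) * s ^ (q - 1)\<close>,
      where \<open>q = 2 ^ k\<close>.\<close>
    define z where "z = (a / c) * (fr ?k s / s)"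
    have a: "a * fr ?k s = z * (c * s)" using \<open>c \<noteq> 0\<close> \<open>s \<noteq> 0\<close> by (simp add: z_def)
    then have a': "fr ?k a * fr (2 * ?k) s = fr ?k z * (fr ?k c * fr ?k s)"
      by (metis fr_mult fr_fr mult_2)
    have "(fr ?k z * z + z + \<gamma>) * (fr ?k c * fr ?k s * (c * s)) =
      fr ?k s * (fr (2 * ?k) s * (fr ?k a * a) + fr ?k s * (a * fr ?k c) + \<gamma> * (s * (fr ?k c * c)))"
    proof -
      have "(fr ?k z * z + z + \<gamma>) * (fr ?k c * fr ?k s * (c * s))
        = (fr ?k z * (fr ?k c * fr ?k s)) * (z * (c * s)) + fr ?k c * fr ?k s * (z * (c * s))
          + \<gamma> * (fr ?k c * fr ?k s * (c * s))"
        by (simp only: distrib_left distrib_right ac_simps)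
      then show ?thesis unfolding a[symmetric] a'[symmetric] by (simp only: distrib_left ac_simps)
    qed
    then show False
      using sum0 \<open>rootfree ?k \<gamma>\<close> \<open>c \<noteq> 0\<close> \<open>s \<noteq> 0\<close> by (simp add: rootfree_def)
  qed
  then have "r = 0 \<or> r = 1" using fr_fixed_imp[OF k] by (simp add: s_def)
  then show ?thesis by (auto simp: u w r zero_prod_def)
qed

text \<open>With both second coordinates zero, only \<open>fr k x * y + x * fr k y\<close> survives,
  whose gaps \<open>k\<close> and \<open>- k\<close> differ modulo \<open>m\<close>; hence
  \<open>S\<close> vanishes on first coordinates. The value \<open>(x, x)\<close> at
  \<open>(x, 0)\<close> and \<open>(0, 1)\<close> then handles second coordinates.\<close>

lemma bp_span:
  assumes k: "\<not> int m dvd 2 * k"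
    and S: "additive S" "\<And>u w. S (bp k \<gamma> u w) = (0 :: 'a)"
  shows "S p = 0"
proof -
  interpret S: additive S by fact
  define T1 T2 where "T1 x = S (x, 0)" and "T2 x = S (0, x)" for x
  have S_eq: "S (x, y) = T1 x + T2 y" for x y
    using S.add[of "(x, 0)" "(0, y)"] by (simp add: T1_def T2_def)
  have T: "additive T1" "additive T2"
    unfolding additive_def T1_def T2_def by (metis S.add add_Pair add_0)+
  have "T1 (fr k x * fr 0 y * 1) + T1 (fr 0 x * fr k y * 1) = fr 0 x * fr 0 y * 0" for x y
    using S(2)[of "(x, 0)" "(y, 0)"]
    by (simp add: bp_apply S_eq additive.zero[OF T(2)] additive.add[OF T(1)])
  then have e: "bicoef (\<lambda>x y. T1 (fr k x * fr 0 y * 1) + T1 (fr 0 x * fr k y * 1)) i j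
    = bicoef (\<lambda>x y. fr 0 x * fr 0 y * 0) i j" for i j
    by (simp only:)
  have coefs: "coef T1 (i - k) * kd (j - i + k) + coef T1 i * kd (j - i - k) = 0" for i j
    using e[of i j]
    by (simp only: bicoef_add biadditive_add bicoef_twist[OF T(1)] biadditive_twist[OF T(1)]
       bicoef_left[OF additive_fr]) simp
  have "coef T1 i = 0" for i
    using coefs[of i "i + k"] k by (simp add: kd_def)
  then have T1: "T1 x = 0" for x by (rule additive_eq_0I[OF T(1)])
  have "T2 x = 0" for x
    using S(2)[of "(x, 0)" "(0, 1)"] by (simp add: bp_apply S_eq T1)
  then show ?thesis by (cases p) (simp add: S_eq T1)
qed

section \<open>Taniguchi functions\<close>

lemma taniguchi_apply:
  "taniguchi k \<alpha> \<beta> (x, y) =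
    (fr (3 * int k) x * fr (2 * int k) x + \<alpha> * fr (2 * int k) x * fr (int k) y + \<beta> * (fr (int k) y * y), x * y)"
proof -
  have fr2: "fr (2 * int k) z = z ^ 2 ^ (2 * k)" for z
    using fr_of_nat[of "2 * k" z] by simp
  have "z ^ (2 ^ (2 * k) * (2 ^ k + 1)) = fr (3 * int k) z * fr (2 * int k) z" for z
  proof -
    have "z ^ (2 ^ (2 * k) * (2 ^ k + 1)) = fr (int k) (fr (2 * int k) z) * fr (2 * int k) z"
      unfolding fr2 fr_of_nat by (simp add: power_mult[symmetric] power_add algebra_simps)
    then show ?thesis by (simp add: fr_fr)
  qed
  moreover have "z ^ (2 ^ k + 1) = fr (int k) z * z" for z
    by (simp add: fr_of_nat)
  ultimately show ?thesis by (simp only: taniguchi_def prod.case fr2 fr_of_nat)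
qed

definition twist2 :: "int \<Rightarrow> 'a \<times> 'a \<Rightarrow> 'a \<times> 'a" where
  "twist2 k p = (fst p, fr (2 * k) (snd p))"

definition twist1 :: "int \<Rightarrow> 'a \<times> 'a \<Rightarrow> 'a \<times> 'a" where
  "twist1 k p = (fr (2 * k) (fst p), snd p)"

lemma additive_twist: "additive (twist1 k)" "additive (twist2 k)"
  by (simp_all add: additive_def twist1_def twist2_def fr_add)

lemma twist_inverse [simp]:
  "twist1 k (twist1 (- k) p) = p" "twist1 (- k) (twist1 k p) = p"
  "twist2 k (twist2 (- k) p) = p" "twist2 (- k) (twist2 k p) = p"
  by (simp_all add: twist1_def twist2_def fr_fr)

lemma bij_twist: "bij (twist1 k)" "bij (twist2 k)"
  by (rule bij_betw_byWitness[where f' = "twist1 (- k)"]; simp)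
     (rule bij_betw_byWitness[where f' = "twist2 (- k)"]; simp)

text \<open>With \<open>q = 2 ^ k\<close>, substituting \<open>twist2\<close> in the arguments makes
  the first component of the value a \<open>q\<^sup>2\<close>-th power, which \<open>twist1\<close>
  collects; this is why the parameter appears as \<open>fr (2 * int k) \<gamma>\<close>.\<close>

lemma polar_taniguchi:
  "polar (taniguchi k 1 (fr (2 * int k) \<gamma>)) (twist2 (int k) u) (twist2 (int k) w)
    = twist1 (int k) (bp (int k) \<gamma> u w)"
  by (cases u; cases w)
     (simp add: polar_def taniguchi_apply twist1_def twist2_def bp_apply fr_add fr_mult fr_fr
        algebra_simps two)

lemma rootfree_fr: "rootfree k (fr i \<gamma>) \<longleftrightarrow> rootfree k \<gamma>"
proof -
  have imp: "rootfree k (fr i \<gamma>)" if "rootfree k \<gamma>" for i \<gamma>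
    unfolding rootfree_def
  proof
    fix z
    have "fr k z * z + z + fr i \<gamma> = fr i (fr k (fr (- i) z) * fr (- i) z + fr (- i) z + \<gamma>)"
      by (simp add: fr_add fr_mult fr_fr)
    then show "fr k z * z + z + fr i \<gamma> \<noteq> 0"
      using that unfolding rootfree_def by (metis fr_eq_0_iff)
  qed
  show ?thesis using imp[of \<gamma> i] imp[of "fr i \<gamma>" "- i"] by (auto simp: fr_fr)
qed

lemma not_dvd_small_mult:
  assumes "coprime k m" "0 < j" "j < m"
  shows "\<not> int m dvd int j * int k"
proof
  assume "int m dvd int j * int k"
  then have "m dvd j * k" by (metis of_nat_dvd_iff of_nat_mult)
  then have "m dvd j" using assms(1) by (simp add: coprime_commute coprime_dvd_mult_left_iff)
  then show False using assms by (simp add: nat_dvd_not_less)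
qed

lemma bp_add_left: "bp k \<gamma> (u + v) w = bp k \<gamma> u w + bp k \<gamma> v w"
  by (cases u; cases v; cases w) (simp add: bp_apply fr_add algebra_simps)

text \<open>The properties are carried over from \<open>bp\<close> through the additive bijections
  \<open>twist1\<close> and \<open>twist2\<close>. The bound \<open>m \<ge> 3\<close> makes
  \<open>2 * k\<close> nonzero modulo \<open>m\<close> and gives the space at least 64
  elements.\<close>

lemma quadratic_apn_taniguchi:
  assumes "m \<ge> 3" and k: "coprime k m" and "rootfree (int k) \<beta>"
  shows "quadratic_apn (taniguchi k 1 \<beta>)"
proof
  define \<gamma> where "\<gamma> = fr (- (2 * int k)) \<beta>"
  have \<beta>: "\<beta> = fr (2 * int k) \<gamma>" by (simp add: \<gamma>_def fr_fr)
  have \<gamma>: "rootfree (int k) \<gamma>" using assms by (simp add: \<gamma>_def rootfree_fr)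
  let ?k = "int k"
  have polar_eq: "polar (taniguchi k 1 \<beta>) u w = twist1 ?k (bp ?k \<gamma> (twist2 (- ?k) u) (twist2 (- ?k) w))" for u w
    using polar_taniguchi[of k \<gamma> "twist2 (- ?k) u" "twist2 (- ?k) w"] by (simp add: \<beta>)
  show "x + x = 0" for x :: "'a \<times> 'a" by (cases x) (simp add: two zero_prod_def)
  show "taniguchi k 1 \<beta> 0 = 0" by (simp add: zero_prod_def taniguchi_apply)
  show "polar (taniguchi k 1 \<beta>) (x + y) z
      = polar (taniguchi k 1 \<beta>) x z + polar (taniguchi k 1 \<beta>) y z" for x y z
    by (simp add: polar_eq additive.add[OF additive_twist(1)] additive.add[OF additive_twist(2)] bp_add_left)
  show "x = 0 \<or> x = a" if "polar (taniguchi k 1 \<beta>) x a = 0" "a \<noteq> 0" for x a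
  proof -
    have inj: "twist1 i p = 0 \<longleftrightarrow> p = 0" "twist2 i p = 0 \<longleftrightarrow> p = 0" "twist2 i p = twist2 i q \<longleftrightarrow> p = q"
      for i p q by (auto simp: twist1_def twist2_def zero_prod_def prod_eq_iff)
    have "twist2 (- ?k) x = 0 \<or> twist2 (- ?k) x = twist2 (- ?k) a"
      by (rule bp_eq_0[OF k \<gamma>]) (use that in \<open>simp_all add: polar_eq inj\<close>)
    then show ?thesis by (simp add: inj)
  qed
  show "S y = 0" if S: "additive S" "\<And>x y. S (polar (taniguchi k 1 \<beta>) x y) = 0"
    for S :: "'a \<times> 'a \<Rightarrow> 'a \<times> 'a" and y
  proof -
    have S0: "S (twist1 ?k (bp ?k \<gamma> u w)) = 0" for u w
      using S(2)[of "twist2 ?k u" "twist2 ?k w"] by (simp add: polar_eq)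
    have add: "additive (\<lambda>p. fst (S (twist1 ?k p)))" "additive (\<lambda>p. snd (S (twist1 ?k p)))"
      by (rule additive.intro, simp only: additive.add[OF additive_twist(1)] additive.add[OF S(1)] fst_add snd_add)+
    have "\<not> int m dvd 2 * ?k" using not_dvd_small_mult[OF k, of 2] assms by simp
    note span = bp_span[OF this add(1), of \<gamma>] bp_span[OF this add(2), of \<gamma>]
    have "S (twist1 ?k p) = 0" for p
      using span[of p] S0 by (simp add: prod_eq_iff)
    from this[of "twist1 (- ?k) y"] show ?thesis by simp
  qed
  have "(2::nat) ^ 3 * 2 ^ 3 \<le> 2 ^ m * 2 ^ m"
    using assms by (intro mult_mono power_increasing) auto
  then show "16 < CARD('a \<times> 'a)" by (simp add: card_field)
qed

text \<open>The twists turn the equivalence of polarizations into one of \<open>bp\<close> maps. The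
  bound \<open>m \<ge> 4\<close> keeps \<open>3 * l\<close> nonzero modulo \<open>m\<close>, and
  \<open>2 * k < m\<close> with \<open>2 * l < m\<close> excludes that \<open>l\<close> is congruent
  to \<open>- k\<close>.\<close>

lemma taniguchi_ccz_equivalent_imp:
  assumes "m \<ge> 4" and k: "coprime k m" "0 < k" "2 * k < m" "rootfree (int k) \<beta>"
    and l: "coprime l m" "0 < l" "2 * l < m" "rootfree (int l) \<delta>"
    and ccz: "ccz_equivalent (taniguchi k 1 \<beta>) (taniguchi l 1 \<delta>)"
  shows "k = l \<and> (\<exists>s. \<delta> = fr s \<beta>)"
proof -
  let ?k = "int k" and ?l = "int l"
  define \<gamma> \<epsilon> where "\<gamma> = fr (- (2 * ?k)) \<beta>" and "\<epsilon> = fr (- (2 * ?l)) \<delta>"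
  have \<beta>: "\<beta> = fr (2 * ?k) \<gamma>" and \<delta>: "\<delta> = fr (2 * ?l) \<epsilon>" by (simp_all add: \<gamma>_def \<epsilon>_def fr_fr)
  have \<epsilon>: "rootfree ?l \<epsilon>" using l by (simp add: \<epsilon>_def rootfree_fr)
  interpret f: quadratic_apn "taniguchi l 1 \<delta>" using quadratic_apn_taniguchi assms by simp
  have "quadratic_apn (taniguchi k 1 \<beta>)" using quadratic_apn_taniguchi assms by simp
  then obtain L M where L: "additive L" "bij L" and M: "additive M" "bij M"
    and LM: "\<And>x y. polar (taniguchi l 1 \<delta>) (L x) (L y) = M (polar (taniguchi k 1 \<beta>) x y)"
    using f.ccz_equivalent_imp_linear_equivalent[OF _ ccz] by metis
  let ?L = "twist2 (- ?l) \<circ> L \<circ> twist2 ?k" and ?M = "twist1 (- ?l) \<circ> M \<circ> twist1 ?k"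
  have additive_comp: "additive (g \<circ> h)" if "additive g" "additive h"
    for g h :: "'a \<times> 'a \<Rightarrow> 'a \<times> 'a"
    using that by (simp add: additive_def del: split_paired_All)
  have "bp ?l \<epsilon> (?L u) (?L w) = ?M (bp ?k \<gamma> u w)" for u w
  proof -
    have "twist1 ?l (bp ?l \<epsilon> (?L u) (?L w)) = polar (taniguchi l 1 \<delta>) (L (twist2 ?k u)) (L (twist2 ?k w))"
      unfolding \<delta> polar_taniguchi[symmetric] by simp
    also have "\<dots> = M (twist1 ?k (bp ?k \<gamma> u w))"
      unfolding LM \<beta> polar_taniguchi ..
    finally show ?thesis by (metis comp_apply twist_inverse(2))
  qed
  moreover have "k = l" if dvd: "int m dvd ?l - ?k \<or> int m dvd ?l + ?k"
  proof -
    have "\<not> int m dvd ?l + ?k" using k l by (intro zdvd_not_zless) auto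
    then have "int m dvd ?l - ?k" using dvd by blast
    moreover have "\<bar>?l - ?k\<bar> < int m" using k l by linarith
    ultimately show ?thesis by (metis abs_dvd_iff dvd_abs_iff eq_iff_diff_eq_0 of_nat_eq_iff zdvd_not_zless zero_less_abs_iff)
  qed
  ultimately have "?k = ?l \<and> (\<exists>s. \<epsilon> = fr s \<gamma>)"
    using not_dvd_small_mult[OF l(1), of 1] not_dvd_small_mult[OF l(1), of 2]
      not_dvd_small_mult[OF l(1), of 3] \<open>m \<ge> 4\<close> \<epsilon> L M
    by (intro bp_equivalence[of ?l \<epsilon> ?L ?M])
       (auto intro!: additive_comp additive_twist bij_comp bij_twist)
  then obtain s where "k = l" "\<epsilon> = fr s \<gamma>" by auto
  then have "\<delta> = fr s \<beta>" by (simp add: \<beta> \<delta> fr_fr add.commute)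
  then show ?thesis using \<open>k = l\<close> by blast
qed

section \<open>Counting\<close>

lemma card_quadratic_fibre_le:
  assumes k: "coprime k m"
  shows "card {z. fr (int k) z * z + z = b} \<le> 3"
proof (cases "\<exists>z0. fr (int k) z0 * z0 + z0 = b")
  case False
  then show ?thesis by simp
next
  case True
  then obtain z0 where z0: "fr (int k) z0 * z0 + z0 = b" by blast
  let ?k = "int k"
  text \<open>The reciprocals of the differences to \<open>z0\<close> solve an affine equation whose homogeneous
    part has at most one nonzero solution.\<close>
  define E where "E = {e. e \<noteq> 0 \<and> (fr ?k z0 + 1) * fr ?k e + z0 * e = 1}"
  have sub: "{z. fr ?k z * z + z = b} \<subseteq> insert z0 ((\<lambda>e. z0 + 1 / e) ` E)"
  proof
    fix z assume z: "z \<in> {z. fr ?k z * z + z = b}"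
    show "z \<in> insert z0 ((\<lambda>e. z0 + 1 / e) ` E)"
    proof (cases "z = z0")
      case False
      define d where "d = z0 + z"
      have "d \<noteq> 0" using False by (auto simp: d_def)
      have zd: "z = z0 + d" by (simp add: d_def)
      have "fr ?k z0 * d + fr ?k d * z0 + fr ?k d * d + d = (fr ?k z * z + z) + (fr ?k z0 * z0 + z0)"
        unfolding zd by (simp add: fr_add algebra_simps)
      also have "\<dots> = 0" using z z0 by simp
      finally have d0: "fr ?k z0 * d + fr ?k d * z0 + fr ?k d * d + d = 0" .
      define e where "e = 1 / d"
      have e: "e * d = 1" "fr ?k e * fr ?k d = 1"
        using \<open>d \<noteq> 0\<close> by (simp_all add: e_def fr_mult[symmetric])
      \<comment> \<open>Multiplying by \<open>e * fr ?k e\<close> turns the equation for the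
        difference \<open>d\<close> into an affine one for its reciprocal.\<close>
      have "e * fr ?k e * (fr ?k z0 * d + fr ?k d * z0 + fr ?k d * d + d)
        = (e * d) * (fr ?k e * fr ?k z0) + (fr ?k e * fr ?k d) * (e * z0)
          + (fr ?k e * fr ?k d) * (e * d) + (e * d) * fr ?k e"
        by (simp only: distrib_left ac_simps)
      then have "fr ?k e * fr ?k z0 + e * z0 + 1 + fr ?k e = 0"
        unfolding e d0 by simp
      then have "(fr ?k z0 + 1) * fr ?k e + z0 * e + 1 = 0"
        by (simp only: distrib_left distrib_right mult_1 mult_1_right ac_simps)
      then have "e \<in> E" using \<open>d \<noteq> 0\<close> by (simp add: E_def e_def)
      then show ?thesis using zd e_def by (intro insertI2 image_eqI[of _ _ e]) auto
    qed simp
  qed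
  have "card E \<le> 2"
  proof (cases "\<exists>e1\<in>E. \<exists>e2\<in>E. e1 \<noteq> e2")
    case False
    then have "card E \<le> Suc 0" by (subst card_le_Suc0_iff_eq) auto
    then show ?thesis by simp
  next
    case True
    then obtain e1 e2 where e: "e1 \<in> E" "e2 \<in> E" "e1 \<noteq> e2" by blast
    have hom: "(fr ?k z0 + 1) * fr ?k (e1 + e) = z0 * (e1 + e)" if "e \<in> E" for e
    proof -
      have "((fr ?k z0 + 1) * fr ?k e1 + z0 * e1) + ((fr ?k z0 + 1) * fr ?k e + z0 * e) = 0"
        using e that by (simp add: E_def)
      then have "(fr ?k z0 + 1) * fr ?k (e1 + e) + z0 * (e1 + e) = 0"
        by (simp only: fr_add distrib_left ac_simps)
      then show ?thesis by simp
    qed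
    have "E \<subseteq> {e1, e2}"
    proof
      fix e assume "e \<in> E"
      show "e \<in> {e1, e2}"
      proof (rule ccontr)
        assume ne: "e \<notin> {e1, e2}"
        define u v where "u = e1 + e" and "v = e1 + e2"
        \<comment> \<open>The quotient of two nonzero homogeneous solutions is fixed by
          \<open>fr ?k\<close>, hence equal to 1, which contradicts the choice of a third
          element.\<close>
        define w where "w = u / v"
        have nz: "u \<noteq> 0" "v \<noteq> 0" using ne e by (auto simp: u_def v_def)
        have hom_u: "(fr ?k z0 + 1) * fr ?k u = z0 * u" and hom_v: "(fr ?k z0 + 1) * fr ?k v = z0 * v"
          using hom \<open>e \<in> E\<close> e(2) by (simp_all only: u_def v_def)
        have "fr ?k z0 + 1 \<noteq> 0"
          using hom_v nz e(1) by (auto simp: E_def)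
        moreover have "(fr ?k z0 + 1) * (fr ?k u * v) = (fr ?k z0 + 1) * (fr ?k v * u)"
          using hom_u hom_v by (metis mult.assoc mult.commute)
        ultimately have "fr ?k u * v = fr ?k v * u" by simp
        moreover have "u = w * v" using nz by (simp add: w_def)
        ultimately have "fr ?k v * v * fr ?k w = fr ?k v * v * w" by (simp add: fr_mult ac_simps)
        then have "fr ?k w = w" using nz by simp
        then have "w = 0 \<or> w = 1" by (rule fr_fixed_imp[OF k])
        then have "u = v" using \<open>u = w * v\<close> nz by auto
        then show False using ne by (simp add: u_def v_def)
      qed
    qed
    then have "card E \<le> card {e1, e2}" by (simp add: card_mono)
    also have "\<dots> \<le> 2" by (simp add: card_insert_if)
    finally show ?thesis .
  qed
  have "card {z. fr ?k z * z + z = b} \<le> card (insert z0 ((\<lambda>e. z0 + 1 / e) ` E))"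
    by (rule card_mono[OF _ sub]) simp
  also have "\<dots> \<le> Suc (card ((\<lambda>e. z0 + 1 / e) ` E))" by (rule card_insert_le_m1) auto
  also have "\<dots> \<le> 3"
    using card_image_le[of E "\<lambda>e. z0 + 1 / e"] \<open>card E \<le> 2\<close> by simp
  finally show ?thesis .
qed

text \<open>Second moment of the fibre sizes of \<open>z \<mapsto> z ^ (q + 1) + z\<close>; the values outside its range
  are the \<open>\<beta>\<close> for which \<open>X ^ (q + 1) + X + \<beta>\<close> has no root.\<close>

lemma card_rootfree_ge:
  assumes k: "coprime k m"
  shows "2 ^ m \<le> 3 * card {\<beta>. rootfree (int k) \<beta>} + 1"
proof -
  let ?k = "int k"
  have card_compl: "card A + card (- A) = 2 ^ m" for A :: "'a set"
    by (metis Compl_disjoint Compl_partition card_Un_disjoint card_field finite)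
  define g where "g z = fr ?k z * z + z" for z
  define r where "r b = card {z. g z = b}" for b
  have rootfree: "{\<beta>. rootfree ?k \<beta>} = - range g"
    by (auto simp: rootfree_def g_def)
  have sum_r: "(\<Sum>b\<in>range g. r b) = 2 ^ m"
    using sum.image_gen[of "UNIV :: 'a set" "\<lambda>_. 1::nat" g] by (simp add: r_def card_field)
  \<comment> \<open>\<open>Q\<close> collects the pairs with equal \<open>g\<close>-values, so its
    size is the second moment.\<close>
  define Q where "Q = (SIGMA z:UNIV. {z'. g z' = g z})"
  have "card Q = (\<Sum>z\<in>UNIV. r (g z))" by (simp add: Q_def r_def)
  also have "\<dots> = (\<Sum>b\<in>range g. r b * r b)"
    using sum.image_gen[of "UNIV :: 'a set" "\<lambda>z. r (g z)" g] by (simp add: r_def)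
  finally have sum_sq: "(\<Sum>b\<in>range g. r b * r b) = card Q" ..
  \<comment> \<open>A pair \<open>z\<close>, \<open>z + d\<close> with \<open>d \<noteq> 0\<close>
    is parametrized by \<open>w = z / d\<close>. Equality of the \<open>g\<close>-values becomes
    \<open>fr ?k d * (fr ?k w + w + 1) = 1\<close>, which determines \<open>d\<close> from
    \<open>w\<close> in \<open>W\<close>.\<close>
  define W where "W = {w. fr ?k w + w + 1 \<noteq> 0}"
  define d where "d w = fr (- ?k) (1 / (fr ?k w + w + 1))" for w
  define h where "h w = (d w * w, d w * w + d w)" for w
  have d: "d w \<noteq> 0" "fr ?k (d w) * (fr ?k w + w + 1) = 1" if "w \<in> W" for w
    using that by (simp_all add: d_def W_def fr_fr)
  \<comment> \<open>Two elements of \<open>- W\<close> differ by a fixed point of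
    \<open>fr ?k\<close>, so at most two elements are excluded.\<close>
  have "card W \<ge> 2 ^ m - 2"
  proof -
    have "card (- W) \<le> 2"
    proof (cases "- W = {}")
      case False
      then obtain w0 where w0: "fr ?k w0 + w0 = 1" by (auto simp: W_def)
      have "- W \<subseteq> {w0, w0 + 1}"
      proof
        fix w assume "w \<in> - W"
        then have "fr ?k w + w = 1" by (simp add: W_def)
        then have "fr ?k (w + w0) + (w + w0) = (fr ?k w + w) + (fr ?k w0 + w0)"
          by (simp add: fr_add ac_simps)
        then have "fr ?k (w + w0) = w + w0" using w0 \<open>fr ?k w + w = 1\<close> by simp
        then have "w + w0 = 0 \<or> w + w0 = 1" by (rule fr_fixed_imp[OF k])
        moreover have "w = w0 + (w + w0)" by (simp add: add.commute)
        ultimately show "w \<in> {w0, w0 + 1}" by (metis add.right_neutral insert_iff)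
      qed
      then have "card (- W) \<le> card {w0, w0 + 1}" by (rule card_mono[rotated]) simp
      also have "\<dots> \<le> 2" by (simp add: card_insert_if)
      finally show ?thesis .
    qed (simp only: card.empty)
    then show ?thesis using card_compl[of W] by linarith
  qed
  moreover have "inj_on h W"
  proof (rule inj_onI)
    fix w w' assume ww: "w \<in> W" "w' \<in> W" and "h w = h w'"
    then have "d w * w = d w' * w'" "d w = d w'" by (auto simp: h_def)
    then show "w = w'" using d(1)[OF ww(2)] by simp
  qed
  then have "card (h ` W) = card W" by (rule card_image)
  moreover have "h ` W \<union> range (\<lambda>z. (z, z)) \<subseteq> Q"
  proof -
    have "g (d w * w + d w) = g (d w * w)" if "w \<in> W" for w
    proof -
      have "g (d w * w + d w) + g (d w * w) = d w * (fr ?k (d w) * (fr ?k w + w + 1) + 1)"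
        by (simp add: g_def fr_add fr_mult algebra_simps)
      also have "\<dots> = 0" by (simp add: d(2)[OF that])
      finally show ?thesis by simp
    qed
    then show ?thesis by (auto simp: Q_def h_def)
  qed
  then have "card (h ` W \<union> range (\<lambda>z. (z, z))) \<le> card Q" by (intro card_mono) auto
  moreover have "h ` W \<inter> range (\<lambda>z. (z, z)) = {}" using d(1) by (auto simp: h_def)
  then have "card (h ` W \<union> range (\<lambda>z. (z, z))) = card (h ` W) + card (range (\<lambda>z :: 'a. (z, z)))"
    by (intro card_Un_disjoint) auto
  moreover have "card (range (\<lambda>z :: 'a. (z, z))) = 2 ^ m"
    by (simp add: card_image inj_on_def card_field)
  ultimately have card_Q: "card Q + 2 \<ge> 2 * 2 ^ m" by linarith
  \<comment> \<open>Since \<open>r b\<close> lies between 1 and 3,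
    \<open>(r b - 1) * (r b - 3) \<le> 0\<close> over the integers. The value 0 has exactly the
    preimages 0 and 1, and \<open>r b = 2\<close> gains the extra 1.\<close>
  have "r b * r b + 3 + of_bool (b = 0) \<le> 4 * r b" if b: "b \<in> range g" for b
  proof -
    have "r b \<noteq> 0" using b by (auto simp: r_def)
    moreover have "r b \<le> 3" unfolding r_def g_def by (rule card_quadratic_fibre_le[OF k])
    ultimately have cases: "r b = 1 \<or> r b = 2 \<or> r b = 3" by linarith
    show ?thesis
    proof (cases "b = 0")
      case True
      have "{z. g z = 0} = {0, 1}"
      proof -
        have "g z = z * (fr ?k z + 1)" for z by (simp add: g_def algebra_simps)
        then have "g z = 0 \<longleftrightarrow> z = 0 \<or> fr ?k z = fr ?k 1" for z by simp
        then show ?thesis by (auto simp del: fr_one)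
      qed
      then have "r b = 2" by (simp add: r_def True)
      then show ?thesis by simp
    qed (use cases in auto)
  qed
  then have "(\<Sum>b\<in>range g. r b * r b + 3 + of_bool (b = 0)) \<le> (\<Sum>b\<in>range g. 4 * r b)"
    by (rule sum_mono)
  moreover have "(\<Sum>b\<in>range g. of_bool (b = 0) :: nat) = 1"
  proof -
    have "g 0 = 0" by (simp add: g_def)
    then have "0 \<in> range g" by (metis rangeI)
    then show ?thesis by (simp add: of_bool_def)
  qed
  ultimately have "card Q + 3 * card (range g) + 1 \<le> 4 * 2 ^ m"
    by (simp add: sum.distrib sum_sq sum_distrib_left[symmetric] sum_r)
  then have "3 * card (range g) \<le> 2 * 2 ^ m + 1" using card_Q by linarith
  moreover have "card {\<beta>. rootfree ?k \<beta>} = 2 ^ m - card (range g)"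
    unfolding rootfree using card_compl[of "range g"] by linarith
  moreover have "card (range g) \<le> 2 ^ m" by (metis card_field card_mono finite subset_UNIV)
  ultimately show ?thesis by linarith
qed

end

text \<open>For \<open>m \<ge> 3\<close> no totative equals \<open>m\<close> or half of
  \<open>m\<close>, so each one lies in the lower half or is the reflection \<open>m - k\<close> of
  one that does.\<close>

lemma totient_le_twice_card:
  assumes "m \<ge> 3"
  shows "totient m \<le> 2 * card {k. 0 < k \<and> 2 * k < m \<and> coprime k m}"
proof -
  let ?K = "{k. 0 < k \<and> 2 * k < m \<and> coprime k m}"
  have fin: "finite ?K" by (rule finite_subset[of _ "{..m}"]) auto
  have "totatives m \<subseteq> ?K \<union> (\<lambda>k. m - k) ` ?K"
  proof
    fix k assume "k \<in> totatives m"
    then have k: "0 < k" "k \<le> m" "coprime k m" by (auto simp: totatives_def)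
    have "2 * k \<noteq> m"
    proof
      assume "2 * k = m"
      then have "k dvd gcd k m" by (metis dvd_triv_right gcd_greatest dvd_refl)
      then have "k = 1" using k by simp
      then show False using \<open>2 * k = m\<close> assms by simp
    qed
    moreover have "k \<noteq> m" using k assms by auto
    moreover have "m - k \<in> ?K" if "m < 2 * k" "k \<noteq> m"
    proof -
      have "gcd (m - k) m = gcd k m"
        using k gcd_diff2_nat[of "m - k" m] by (simp add: gcd.commute)
      then show ?thesis using that k by (auto simp: coprime_iff_gcd_eq_1)
    qed
    moreover have "k = m - (m - k)" using k by simp
    ultimately show "k \<in> ?K \<union> (\<lambda>k. m - k) ` ?K"
      using k by (cases "2 * k < m") (auto intro!: image_eqI[of _ _ "m - k"])
  qed
  then have "card (totatives m) \<le> card (?K \<union> (\<lambda>k. m - k) ` ?K)"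
    using fin by (intro card_mono) auto
  also have "\<dots> \<le> card ?K + card ((\<lambda>k. m - k) ` ?K)" by (rule card_Un_le)
  also have "\<dots> \<le> 2 * card ?K" using card_image_le[OF fin] by simp
  finally show ?thesis by (simp add: totient_def)
qed

text \<open>The bound \<open>2 ^ m - 1\<close> improves to \<open>2 ^ m + 1\<close> for multiples of \<open>3 * m\<close>: for odd \<open>m\<close>, 3 divides
  neither \<open>2 ^ m - 1\<close> nor \<open>2 ^ m\<close>, and for even \<open>m\<close> the multiple is even.\<close>

lemma multiple_ge_power_two_plus_one:
  fixes m n :: nat
  assumes "2 ^ m \<le> 3 * m * n + 1" "m > 0"
  shows "2 ^ m + 1 \<le> 3 * m * n"
proof (rule ccontr)
  assume "\<not> ?thesis"
  then have "3 * m * n = 2 ^ m \<or> 3 * m * n + 1 = 2 ^ m" using assms by linarith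
  then show False
  proof
    assume "3 * m * n = 2 ^ m"
    then have "3 dvd (2::nat) ^ m" by (metis dvd_triv_left mult.assoc)
    moreover have "\<not> 3 dvd (2::nat) ^ j" for j by (induction j) (auto simp: dvd_def, presburger)
    ultimately show False by blast
  next
    assume eq: "3 * m * n + 1 = 2 ^ m"
    have "odd m"
    proof
      assume "even m"
      then have "odd (3 * m * n + 1)" by simp
      moreover have "even ((2::nat) ^ m)" using assms by simp
      ultimately show False using eq by metis
    qed
    then obtain j where j: "m = 2 * j + 1" by (rule oddE)
    have "(4::nat) ^ j mod 3 = 1"
    proof (induction j)
      case (Suc j)
      have "(4::nat) ^ Suc j mod 3 = (4 * (4 ^ j mod 3)) mod 3" by (simp only: power_Suc mod_mult_right_eq)
      then show ?case by (simp add: Suc)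
    qed simp
    moreover have "(2::nat) ^ m = 2 * 4 ^ j" by (simp add: j power_mult)
    ultimately have "(2::nat) ^ m mod 3 = 2" by presburger
    moreover have "(3 * m * n + 1) mod 3 = 1" by (simp add: mult.assoc)
    ultimately show False using eq by simp
  qed
qed

lemma ccz_equivalent_refl:
  assumes "\<And>v::'v::ab_group_add. v + v = 0"
  shows "ccz_equivalent f (f :: 'v \<Rightarrow> 'v)"
proof -
  have "vector_space (scale2 :: bit \<Rightarrow> 'v \<times> 'v \<Rightarrow> 'v \<times> 'v)"
    by (simp add: vector_space_scale2_iff assms zero_prod_def)
  then have "affine_permutation2 (id :: 'v \<times> 'v \<Rightarrow> _)"
    unfolding affine_permutation2_def
    by (auto simp: Vector_Spaces.linear_iff intro!: exI[of _ id] exI[of _ 0])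
  then show ?thesis unfolding ccz_equivalent_def by (metis image_id id_apply)
qed

section \<open>CCZ classes represented by Taniguchi functions\<close>

context binary_field
begin

abbreviation ccz_class :: "nat \<Rightarrow> 'a \<Rightarrow> ('a \<times> 'a \<Rightarrow> 'a \<times> 'a) set" where
  "ccz_class k \<beta> \<equiv> {(f, g). ccz_equivalent f g} `` {taniguchi k 1 \<beta>}"

lemma ccz_class_in_quotient:
  assumes "m \<ge> 3" "coprime k m" "0 < k" "rootfree (int k) \<beta>"
  shows "ccz_class k \<beta> \<in> taniguchi_apn m // {(f, g). ccz_equivalent f g}"
proof (rule quotientI)
  have "apn (taniguchi k 1 \<beta>)"
    using quadratic_apn_taniguchi assms quadratic_apn.apn_f by blast
  then show "taniguchi k 1 \<beta> \<in> taniguchi_apn m"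
    unfolding taniguchi_apn_def using assms rootfree_nonzero coprime_iff_gcd_eq_1 by blast
qed

text \<open>By reflexivity \<open>taniguchi l 1 \<delta>\<close> lies in its own class, hence in
  that of \<open>taniguchi k 1 \<beta>\<close>.\<close>

lemma ccz_class_eq_imp: "ccz_class k \<beta> = ccz_class l \<delta> \<Longrightarrow> ccz_equivalent (taniguchi k 1 \<beta>) (taniguchi l 1 \<delta>)"
  using ccz_equivalent_refl[of "taniguchi l 1 \<delta>"] by (auto simp: two zero_prod_def)

text \<open>The root-free parameters in one class are Frobenius conjugates of each other, so there
  are at most \<open>m\<close> of them, and the count of root-free parameters bounds
  \<open>m\<close> times the number of classes from below.\<close>

lemma card_ccz_classes_ge:
  assumes "m \<ge> 4" and k: "coprime k m" "0 < k" "2 * k < m"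
  shows "2 ^ m + 1 \<le> 3 * m * card (ccz_class k ` {\<beta>. rootfree (int k) \<beta>})"
proof (rule multiple_ge_power_two_plus_one)
  let ?S = "{\<beta>. rootfree (int k) \<beta>}"
  have fibre: "card {\<beta> \<in> ?S. ccz_class k \<beta> = c} \<le> m" for c
  proof (cases "{\<beta> \<in> ?S. ccz_class k \<beta> = c} = {}")
    case False
    then obtain \<beta>0 where \<beta>0: "rootfree (int k) \<beta>0" "ccz_class k \<beta>0 = c" by blast
    have "{\<beta> \<in> ?S. ccz_class k \<beta> = c} \<subseteq> (\<lambda>i. fr (int i) \<beta>0) ` {..<m}"
    proof
      fix \<beta> assume "\<beta> \<in> {\<beta> \<in> ?S. ccz_class k \<beta> = c}"
      then have "rootfree (int k) \<beta>" "ccz_equivalent (taniguchi k 1 \<beta>0) (taniguchi k 1 \<beta>)"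
        using \<beta>0 by (auto intro!: ccz_class_eq_imp)
      then obtain s where "\<beta> = fr s \<beta>0"
        using taniguchi_ccz_equivalent_imp[OF \<open>m \<ge> 4\<close> k \<beta>0(1) k] by blast
      then have "\<beta> = fr (int (nat (s mod int m))) \<beta>0" using m_pos by (simp add: fr_mod)
      moreover have "nat (s mod int m) < m" using m_pos by (simp add: nat_less_iff)
      ultimately show "\<beta> \<in> (\<lambda>i. fr (int i) \<beta>0) ` {..<m}" by blast
    qed
    then have "card {\<beta> \<in> ?S. ccz_class k \<beta> = c} \<le> card ((\<lambda>i. fr (int i) \<beta>0) ` {..<m})"
      by (rule card_mono[rotated]) simp
    also have "\<dots> \<le> m" using card_image_le[of "{..<m}"] by simp
    finally show ?thesis .
  qed (simp only: card.empty)
  have "card ?S = (\<Sum>c\<in>ccz_class k ` ?S. card {\<beta> \<in> ?S. ccz_class k \<beta> = c})"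
    using sum.image_gen[of ?S "\<lambda>_. 1::nat" "ccz_class k"] by simp
  also have "\<dots> \<le> (\<Sum>c\<in>ccz_class k ` ?S. m)" by (rule sum_mono) (rule fibre)
  finally have "card ?S \<le> m * card (ccz_class k ` ?S)" by (simp add: mult.commute)
  then show "2 ^ m \<le> 3 * m * card (ccz_class k ` ?S) + 1"
    using card_rootfree_ge[OF k(1)] by (simp add: mult.assoc)
qed (rule m_pos)

text \<open>For \<open>m \<ge> 4\<close>, each \<open>k\<close> in \<open>?K\<close> contributes at
  least \<open>?c\<close> classes, different \<open>k\<close> contribute disjoint families, and
  \<open>?K\<close> has at least \<open>totient m / 2\<close> elements.\<close>

theorem num_taniguchi_classes_ge:
  assumes "m \<ge> 3"
  shows "real (num_taniguchi_classes TYPE('a) m)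
    \<ge> real (totient m) / 2 * real_of_int \<lceil>(2 ^ m + 1) / (3 * real m)\<rceil>"
proof -
  let ?Q = "taniguchi_apn m // {(f, g). ccz_equivalent f g} :: ('a \<times> 'a \<Rightarrow> 'a \<times> 'a) set set"
  let ?S = "\<lambda>k. {\<beta>. rootfree (int k) \<beta>}"
  let ?K = "{k. 0 < k \<and> 2 * k < m \<and> coprime k m}"
  let ?c = "\<lceil>(2 ^ m + 1) / (3 * real m)\<rceil>"
  have num: "num_taniguchi_classes TYPE('a) m = card ?Q" by (simp add: num_taniguchi_classes_def)
  have finK: "finite ?K" by (rule finite_subset[of _ "{..m}"]) auto
  have tot: "real (totient m) / 2 \<le> real (card ?K)" using totient_le_twice_card[OF assms] by linarith
  have sub: "ccz_class k ` ?S k \<subseteq> ?Q" if "k \<in> ?K" for k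
    using that ccz_class_in_quotient assms by blast
  have "(0::real) \<le> (2 ^ m + 1) / (3 * real m)" by simp
  then have c_nonneg: "0 \<le> ?c" by linarith
  show ?thesis
  proof (cases "m = 3")
    case True
    have "?K \<subseteq> {1}" using True by auto
    then have "card ?K \<le> 1" using card_mono[of "{1}" ?K] by simp
    then have "real (totient m) / 2 \<le> 1" using tot by linarith
    moreover have c: "?c = 1" using True by simp
    moreover have "1 \<le> card ?Q"
    proof -
      have "2 ^ m \<le> 3 * card (?S 1) + 1" by (rule card_rootfree_ge) simp
      moreover have "(2::nat) ^ m = 8" using True by simp
      ultimately have "card (?S 1) \<noteq> 0" by linarith
      then have "?S 1 \<noteq> {}" by (metis card.empty)
      then have "?Q \<noteq> {}" using ccz_class_in_quotient[of 1] assms by force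
      then show ?thesis by (metis card_0_eq finite less_one not_le)
    qed
    ultimately show ?thesis unfolding num c by linarith
  next
    case False
    then have "m \<ge> 4" using assms by simp
    have c: "real_of_int ?c \<le> real (card (ccz_class k ` ?S k))" if "k \<in> ?K" for k
    proof -
      have "2 ^ m + 1 \<le> 3 * m * card (ccz_class k ` ?S k)"
        using card_ccz_classes_ge \<open>m \<ge> 4\<close> that by simp
      then have "real (2 ^ m + 1) \<le> real (3 * m * card (ccz_class k ` ?S k))" by (rule of_nat_mono)
      then have "(2 ^ m + 1) / (3 * real m) \<le> real (card (ccz_class k ` ?S k))"
        using m_pos by (simp add: divide_le_eq mult.commute)
      then have "?c \<le> int (card (ccz_class k ` ?S k))" by (simp only: ceiling_le_iff of_int_of_nat_eq)
      then show ?thesis by linarith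
    qed
    have "real (card ?K) * ?c \<le> (\<Sum>k\<in>?K. real (card (ccz_class k ` ?S k)))"
      by (rule sum_bounded_below) (rule c)
    also have "\<dots> = real (card (\<Union>k\<in>?K. ccz_class k ` ?S k))"
    proof -
      have "ccz_class k ` ?S k \<inter> ccz_class l ` ?S l = {}" if "k \<in> ?K" "l \<in> ?K" "k \<noteq> l" for k l
        using that taniguchi_ccz_equivalent_imp[OF \<open>m \<ge> 4\<close>, of k _ l] ccz_class_eq_imp[of k _ l] by blast
      then show ?thesis using finK by (subst card_UN_disjoint) auto
    qed
    also have "\<dots> \<le> real (card ?Q)" using sub by (intro of_nat_mono card_mono) auto
    finally have "real (card ?K) * ?c \<le> real (card ?Q)" .
    moreover have "real (totient m) / 2 * ?c \<le> real (card ?K) * ?c"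
      using tot c_nonneg by (intro mult_right_mono) auto
    ultimately show ?thesis unfolding num by linarith
  qed
qed

end

theorem corollary5p6:
  fixes m :: nat
  assumes "m \<ge> 3" and "CARD('a::{finite, field}) = 2 ^ m"
  shows "real (num_taniguchi_classes TYPE('a) m)
    \<ge> real (totient m) / 2 * real_of_int \<lceil>(2 ^ m + 1) / (3 * real m)\<rceil>"
proof -
  interpret binary_field m "TYPE('a)" by unfold_locales (rule assms)
  show ?thesis by (rule num_taniguchi_classes_ge) (rule assms)
qed

end
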